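(* Let $U,V$ be complex vector spaces with $\dim U=2$ and $\dim V=n$, and let $Y\subseteq\mathbb{P}(U^*\otimes S^2V^* )$ be the image of $\mathbb{P}(U^* )\times\mathbb{P}(V^* )$ under the embedding by $\mathcal{O}(1,2)$. For any $r>1$ and any $n$, the secant variety $\sigma_r(Y)$ is defined ideal-theoretically by the ideal $I_{\kappa_0\le r}$; that is, the homogeneous ideal of $\sigma_r(Y)$ equals $I_{\kappa_0\le r}$.
   Context: $\sigma_r(Y)$ is the Zariski closure of the set of $[x]$ with $x=\sum_{i=1}^ru_i\otimes v_i\otimes v_i$, $u_i\in U^*$, $v_i\in V^*$. Write $x\in U^*\otimes S^2V^*$ as $x=e_1\otimes A_1+e_2\otimes A_2$ with $e_1,e_2$ a basis of $U^*$ and $A_1,A_2$ symmetric $n\times n$ matrices. The flattening $\psi_{0,x}\colon V\to V^*\otimes U^*$ is represented by the $2n\times n$ matrix of linear forms obtained by stacking $A_1$ and $A_2$, and $I_{\kappa_0\le r}$ is the ideal of the polynomial ring $S^\bullet(U\otimes S^2V)$ generated by the $(r+1)\times(r+1)$ minors of $\psi_{0,x}$ (the zero ideal if $r\ge n$). *)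

theory Defs
  imports
    "HOL-Analysis.Finite_Cartesian_Product"
    "HOL-Library.Numeral_Type"
    "HOL-Library.Poly_Mapping"
    "HOL-Library.Uprod"
    "Jordan_Normal_Form.Determinant"
begin

no_notation vec_index (infixl "$" 100)

section \<open>Polynomials and projective varieties\<close>

text \<open>
  \<open>'m cpoly\<close> is the polynomial ring over the complex numbers with one variable for every element
  of the finite type \<open>'m\<close>. It is the coordinate ring of the space \<open>complex ^ 'm\<close>.
\<close>

type_synonym 'm cpoly = "('m \<Rightarrow>\<^sub>0 nat) \<Rightarrow>\<^sub>0 complex"

definition pvar :: "'m \<Rightarrow> 'm cpoly" where
  "pvar v = Poly_Mapping.single (Poly_Mapping.single v 1) 1"

definition peval :: "'m::finite cpoly \<Rightarrow> complex ^ 'm \<Rightarrow> complex" where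
  "peval p x = (\<Sum>m\<in>Poly_Mapping.keys p. Poly_Mapping.lookup p m *
                  (\<Prod>v\<in>UNIV. (x $ v) ^ Poly_Mapping.lookup m v))"

definition homogeneous :: "nat \<Rightarrow> 'm::finite cpoly \<Rightarrow> bool" where
  "homogeneous d p \<longleftrightarrow> (\<forall>m\<in>Poly_Mapping.keys p. (\<Sum>v\<in>UNIV. Poly_Mapping.lookup m v) = d)"

text \<open>The ideal generated by \<open>S\<close> is the span of \<open>S\<close> in the ring, viewed as a module over itself.\<close>

definition ideal_generated :: "'a::comm_ring_1 set \<Rightarrow> 'a set" where
  "ideal_generated S = Modules.module.span (*) S"

lemma module_mult: "Modules.module ((*) :: 'a::comm_ring_1 \<Rightarrow> 'a \<Rightarrow> 'a)"
  by standard (auto simp: algebra_simps)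

text \<open>A point of projective space is a line through the origin; \<open>proj_point x\<close> is $[x]$.\<close>

definition proj_point :: "complex ^ 'm \<Rightarrow> (complex ^ 'm) set" where
  "proj_point x = {c *s x | c. True}"

definition proj_space :: "(complex ^ 'm) set set" where
  "proj_space = {proj_point x | x. x \<noteq> 0}"

definition vanishes_at :: "'m::finite cpoly \<Rightarrow> (complex ^ 'm) set \<Rightarrow> bool" where
  "vanishes_at p L \<longleftrightarrow> (\<forall>x\<in>L. peval p x = 0)"

definition zariski_closed :: "(complex ^ 'm::finite) set set \<Rightarrow> bool" where
  "zariski_closed Z \<longleftrightarrow>
     (\<exists>F. (\<forall>p\<in>F. \<exists>d. homogeneous d p) \<and> Z = {L \<in> proj_space. \<forall>p\<in>F. vanishes_at p L})"

definition homogeneous_ideal :: "(complex ^ 'm::finite) set set \<Rightarrow> 'm cpoly set" where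
  "homogeneous_ideal Z =
     ideal_generated {p. (\<exists>d. homogeneous d p) \<and> (\<forall>L\<in>Z. vanishes_at p L)}"

text \<open>
  The union of the lines in \<open>Y\<close> is the affine cone over \<open>Y\<close> (containing \<open>0\<close> if \<open>Y\<close> is nonempty), so
  sums of fewer than \<open>r\<close> cone points are covered as well.
\<close>

definition secant_variety :: "nat \<Rightarrow> (complex ^ 'm::finite) set set \<Rightarrow> (complex ^ 'm) set set" where
  "secant_variety r Y =
     zariski_closed hull
       {proj_point x | x. x \<noteq> 0 \<and> (\<exists>y. (\<forall>i<r. y i \<in> \<Union> Y) \<and> x = (\<Sum>i<r. y i))}"

section \<open>Pencils of symmetric matrices\<close>

instance uprod :: (finite) finite
  by standard simp

text \<open>
  With $U^* = {\bf C}^2$ and $V^* = {\bf C}^n$, where $n$ is the cardinality of \<open>'n\<close>, an element of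
  $U^* \otimes S^2 V^*$ is $e_1 \otimes A_1 + e_2 \otimes A_2$ with $A_1, A_2$ symmetric. It is
  encoded by its coordinates, indexed by \<open>(k, Upair i j)\<close>: the coordinate is the
  entry of $A_k$ in positions $(i,j)$ and $(j,i)$. The indices \<open>1, 2\<close> of type \<open>2\<close> are the two
  distinct elements of that type. Accordingly, $S^\bullet(U \otimes S^2 V)$ is
  \<open>(2 \<times> 'n uprod) cpoly\<close>.
\<close>

type_synonym 'n pencil = "complex ^ (2 \<times> 'n uprod)"

definition slice :: "'n::finite pencil \<Rightarrow> 2 \<Rightarrow> complex ^ 'n ^ 'n" where
  "slice x k = (\<chi> i j. x $ (k, Upair i j))"

lift_definition sym_square :: "complex ^ 'n \<Rightarrow> 'n uprod \<Rightarrow> complex" is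
  "\<lambda>v (i, j). v $ i * v $ j"
  by auto

lemma sym_square_Upair [simp]: "sym_square v (Upair i j) = v $ i * v $ j"
  by transfer simp

text \<open>The tensor $u \otimes v \otimes v$.\<close>

definition tensor_sq :: "complex ^ 2 \<Rightarrow> complex ^ 'n::finite \<Rightarrow> 'n pencil" where
  "tensor_sq u v = (\<chi> w. u $ fst w * sym_square v (snd w))"

text \<open>The image of $P(U^*) \times P(V^*)$ under the embedding by ${\cal O}(1,2)$.\<close>

definition segre_veronese :: "('n::finite pencil) set set" where
  "segre_veronese = {proj_point (tensor_sq u v) | u v. u \<noteq> 0 \<and> v \<noteq> 0}"

text \<open>
  The flattening $\psi_0$ at the generic pencil: a $2n \times n$ matrix of linear forms whose two
  blocks of rows, \<open>(1, _)\<close> and \<open>(2, _)\<close>, are $A_1$ and $A_2$.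
\<close>

definition flattening0 :: "((2 \<times> 'n::finite uprod) cpoly) ^ 'n ^ (2 \<times> 'n)" where
  "flattening0 = (\<chi> w j. pvar (fst w, Upair (snd w) j))"

text \<open>
  Minors of size \<open>s\<close>. The selected rows and columns are listed by injections in any order, so a
  minor may occur together with its negative; there are none if \<open>s\<close> exceeds a dimension of the matrix.
\<close>

definition minors :: "nat \<Rightarrow> 'a::comm_ring_1 ^ 'c::finite ^ 'b::finite \<Rightarrow> 'a set" where
  "minors s M = {Determinant.det (mat s s (\<lambda>(a, b). M $ f a $ g b)) | f g.
                   inj_on f {..<s} \<and> inj_on g {..<s}}"

definition kappa0_ideal :: "nat \<Rightarrow> (2 \<times> 'n::finite uprod) cpoly set" where
  "kappa0_ideal r = ideal_generated (minors (r + 1) flattening0)"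

section \<open>Consistency of the encodings\<close>

lemma bij_betw_slice:
  "bij_betw slice (UNIV :: 'n::finite pencil set) {A. \<forall>k i j. A k $ j $ i = A k $ i $ j}"
proof (rule bij_betwI')
  fix x y :: "'n pencil"
  show "slice x = slice y \<longleftrightarrow> x = y"
  proof
    assume *: "slice x = slice y"
    have "x $ (k, q) = y $ (k, q)" for k q
    proof (cases q)
      case (Upair i j)
      then show ?thesis
        using fun_cong[OF *, of k] by (simp add: slice_def Finite_Cartesian_Product.vec_eq_iff)
    qed
    then show "x = y" by (auto simp: Finite_Cartesian_Product.vec_eq_iff)
  qed simp
next
  fix x :: "'n pencil"
  have *: "Upair i j = Upair j i" for i j :: 'n by simp
  then show "slice x \<in> {A. \<forall>k i j. A k $ j $ i = A k $ i $ j}"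
    by (auto simp: slice_def *)
next
  fix A :: "2 \<Rightarrow> complex ^ 'n ^ 'n"
  assume "A \<in> {A. \<forall>k i j. A k $ j $ i = A k $ i $ j}"
  then have sym: "A k $ j $ i = A k $ i $ j" for k i j
    by blast
  define e where "e k q = (SOME c. \<exists>i j. q = Upair i j \<and> c = A k $ i $ j)" for k q
  have "e k (Upair i j) = A k $ i $ j" for k i j
  proof -
    have "\<exists>a b. Upair i j = Upair a b \<and> e k (Upair i j) = A k $ a $ b"
      unfolding e_def by (rule someI_ex) blast
    then show ?thesis using sym by auto
  qed
  then have "A = slice (\<chi> w. e (fst w) (snd w))"
    by (simp add: fun_eq_iff slice_def Finite_Cartesian_Product.vec_eq_iff)
  then show "\<exists>x\<in>UNIV. A = slice x" by blast
qed

lemma slice_tensor_sq: "slice (tensor_sq u v) k = (\<chi> i j. u $ k * (v $ i * v $ j))"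
  by (simp add: slice_def tensor_sq_def)

lemma peval_pvar: "peval (pvar w) x = x $ w"
proof -
  have "(\<Prod>v\<in>UNIV. (x $ v) ^ Poly_Mapping.lookup (Poly_Mapping.single w (1::nat)) v)
      = (\<Prod>v\<in>UNIV. if v = w then x $ v else 1)"
    by (rule prod.cong) (auto simp: lookup_single when_def)
  then show ?thesis by (simp add: peval_def pvar_def)
qed

lemma peval_flattening0: "peval (flattening0 $ (k, i) $ j) x = slice x k $ i $ j"
  by (simp add: flattening0_def slice_def peval_pvar)

lemma tensor_sq_zero:
  fixes u :: "complex ^ 2" and v :: "complex ^ 'n::finite"
  shows "tensor_sq 0 v = 0" "tensor_sq u (0 :: complex ^ 'n) = 0"
proof -
  have "sym_square 0 q = 0" for q :: "'n uprod" by (cases q) simp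
  then show "tensor_sq 0 v = 0" "tensor_sq u (0 :: complex ^ 'n) = 0"
    by (simp_all add: tensor_sq_def Finite_Cartesian_Product.vec_eq_iff)
qed

lemma cone_segre_veronese:
  "\<Union> (segre_veronese :: ('n::finite pencil) set set) = {tensor_sq u v | u v. True}"
proof (intro Set.set_eqI iffI)
  fix x :: "'n pencil"
  assume "x \<in> \<Union> segre_veronese"
  then obtain u v c where "x = c *s tensor_sq u v"
    by (auto simp: segre_veronese_def proj_point_def)
  then have "x = tensor_sq (c *s u) v"
    by (simp add: tensor_sq_def Finite_Cartesian_Product.vec_eq_iff mult.assoc)
  then show "x \<in> {tensor_sq u v | u v. True}" by blast
next
  fix x :: "'n pencil"
  assume "x \<in> {tensor_sq u v | u v. True}"
  then obtain u v where x: "x = tensor_sq u v" by blast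
  show "x \<in> \<Union> segre_veronese"
  proof (cases "u = 0 \<or> v = 0")
    case True
    then have "x = 0" using x tensor_sq_zero by auto
    then have "x = 0 *s tensor_sq 1 1" by (simp add: Finite_Cartesian_Product.vec_eq_iff)
    moreover have "(1 :: complex ^ 2) \<noteq> 0" "(1 :: complex ^ 'n) \<noteq> 0"
      by (simp_all add: Finite_Cartesian_Product.vec_eq_iff)
    ultimately show ?thesis
      unfolding segre_veronese_def proj_point_def by blast
  next
    case False
    moreover have "x = 1 *s tensor_sq u v" using x by (simp add: Finite_Cartesian_Product.vec_eq_iff)
    ultimately show ?thesis
      unfolding segre_veronese_def proj_point_def by blast
  qed
qed

lemma secant_variety_segre_veronese:
  "secant_variety r (segre_veronese :: ('n::finite pencil) set set) =
     zariski_closed hull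
       {proj_point x | x. x \<noteq> 0 \<and> (\<exists>u v. x = (\<Sum>i<r. tensor_sq (u i) (v i)))}"
proof -
  have "(\<exists>y. (\<forall>i<r. y i \<in> \<Union> segre_veronese) \<and> x = (\<Sum>i<r. y i)) \<longleftrightarrow>
        (\<exists>u v. x = (\<Sum>i<r. tensor_sq (u i) (v i)))" (is "?L \<longleftrightarrow> ?R") for x :: "'n pencil"
  proof
    assume ?L
    then obtain y where y: "\<forall>i<r. \<exists>u v. y i = tensor_sq u v" "x = (\<Sum>i<r. y i)"
      by (auto simp: cone_segre_veronese)
    then obtain u v where "\<forall>i<r. y i = tensor_sq (u i) (v i)" by metis
    with y(2) show ?R by (intro exI[of _ u] exI[of _ v]) simp
  next
    assume ?R
    then obtain u v where "x = (\<Sum>i<r. tensor_sq (u i) (v i))" by blast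
    then show ?L unfolding cone_segre_veronese
      by (intro exI[of _ "\<lambda>i. tensor_sq (u i) (v i)"]) blast
  qed
  then show ?thesis unfolding secant_variety_def by simp
qed

end

theory Submission
  imports
    Defs
    "HOL-Analysis.Topology_Euclidean_Space"
    "HOL-Combinatorics.Permutations"
    "HOL-Computational_Algebra.Polynomial"
begin

text \<open>
  The minors vanish on sums of \<open>r\<close> points of the cone over $Y$, since there the flattening factors
  through an \<open>r\<close>-dimensional space. Conversely, let \<open>p\<close> be a form of degree \<open>d\<close> vanishing on
  these sums. A real pencil \<open>(C, S)\<close> with \<open>C\<close> positive semidefinite and $\ker C \subseteq \ker S$
  is simultaneously diagonalizable, so \<open>p\<close> vanishes on all real pencils in $U^* \otimes S^2 W$
  with \<open>dim W \<le> r\<close>. Polarizing \<open>p\<close> gives, for each choice of \<open>d\<close> basis vectors of $U$, a tensor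
  with \<open>2 d\<close> indices in $V$ that is annihilated by all linear maps to \<open>r\<close>-dimensional spaces.
  By the second fundamental theorem for tensors, proved by a lexicographic straightening of words,
  it is a combination of tensors alternating in \<open>r + 1\<close> positions. Projecting back to
  polynomials, an alternating tensor becomes zero if two of the positions belong to
  the same factor $S^2 V$, and otherwise a multiple of an \<open>(r + 1)\<close>-minor of the flattening.
\<close>

text \<open>The claim compares ideals; agreement of zero sets would leave open whether
  \<open>kappa0_ideal r\<close> is radical. Hence every form vanishing on the secant variety is
  rewritten as an explicit combination of multiples of minors. Two symmetric matrices need not be
  simultaneously diagonalizable. Over the reals, adding a large multiple \<open>t\<close> of the
  Gram matrix of \<open>r\<close> vectors spanning W to the first matrix makes it semidefinite with
  kernel inside that of the second. The value of \<open>p\<close> is polynomial in \<open>t\<close>,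
  so vanishing for all large \<open>t\<close> gives vanishing at \<open>t = 0\<close>. Real vectors
  suffice for a complex tensor because a complex polynomial vanishing on the reals is zero.
  Contracting with vectors chosen among \<open>r\<close> given ones means giving each position one
  of \<open>r\<close> colours. A word without a strictly decreasing chain of \<open>r + 1\<close>
  letters has a colouring with weakly increasing colour classes (Mirsky's theorem for chains). It is
  then the least word with its letters in each class, which is why it can be isolated from all
  smaller words.\<close>

no_notation Matrix.scalar_prod (infix "\<bullet>" 70)

section \<open>Polynomials and their evaluation\<close>

definition monomial :: "('m \<Rightarrow>\<^sub>0 nat) \<Rightarrow> 'm cpoly" where
  "monomial m = Poly_Mapping.single m 1"

definition const :: "complex \<Rightarrow> 'm cpoly" where
  "const c = Poly_Mapping.single 0 c"

definition mon_eval :: "complex ^ 'm::finite \<Rightarrow> ('m \<Rightarrow>\<^sub>0 nat) \<Rightarrow> complex" where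
  "mon_eval x m = (\<Prod>v\<in>UNIV. (x $ v) ^ Poly_Mapping.lookup m v)"

definition mdeg :: "('m::finite \<Rightarrow>\<^sub>0 nat) \<Rightarrow> nat" where
  "mdeg m = (\<Sum>v\<in>UNIV. Poly_Mapping.lookup m v)"

lemma mdeg_add: "mdeg (a + b) = mdeg a + mdeg b"
  by (simp add: mdeg_def lookup_add sum.distrib)

lemma mdeg_single: "mdeg (Poly_Mapping.single v k) = k"
  by (simp add: mdeg_def lookup_single when_def)

lemma homogeneous_iff: "homogeneous d p \<longleftrightarrow> (\<forall>m. Poly_Mapping.lookup p m \<noteq> 0 \<longrightarrow> mdeg m = d)"
  by (auto simp: homogeneous_def mdeg_def in_keys_iff)

lemma mon_eval_add: "mon_eval x (a + b) = mon_eval x a * mon_eval x b"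
  by (simp add: mon_eval_def lookup_add power_add prod.distrib)

lemma peval_eq_sum:
  assumes "finite A" "Poly_Mapping.keys p \<subseteq> A"
  shows "peval p x = (\<Sum>m\<in>A. Poly_Mapping.lookup p m * mon_eval x m)"
  unfolding peval_def mon_eval_def[symmetric]
  using assms by (intro sum.mono_neutral_left) (auto simp: in_keys_iff)

lemma peval_add [simp]: "peval (p + q) x = peval p x + peval q x"
proof -
  let ?A = "Poly_Mapping.keys p \<union> Poly_Mapping.keys q"
  have "Poly_Mapping.keys (p + q) \<subseteq> ?A" by (rule Poly_Mapping.keys_add)
  then show ?thesis
    by (simp add: peval_eq_sum[of ?A] lookup_add distrib_right sum.distrib)
qed

lemma peval_zero [simp]: "peval 0 x = 0"
  by (simp add: peval_def)

lemma peval_sum: "peval (sum f A) x = (\<Sum>a\<in>A. peval (f a) x)"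
  by (induction A rule: infinite_finite_induct) simp_all

lemma peval_single: "peval (Poly_Mapping.single m c) x = c * mon_eval x m"
  by (simp add: peval_eq_sum[of "{m}"])

lemma cpoly_eq_sum: "p = (\<Sum>m\<in>Poly_Mapping.keys p. Poly_Mapping.single m (Poly_Mapping.lookup p m))"
  by (rule poly_mapping_eqI)
     (auto simp: lookup_sum lookup_single when_def in_keys_iff)

lemma peval_mult [simp]: "peval (p * q) x = peval p x * peval q x"
proof -
  have "p * q = (\<Sum>a\<in>Poly_Mapping.keys p. Poly_Mapping.single a (Poly_Mapping.lookup p a)) *
                (\<Sum>b\<in>Poly_Mapping.keys q. Poly_Mapping.single b (Poly_Mapping.lookup q b))"
    using cpoly_eq_sum[of p] cpoly_eq_sum[of q] by simp
  also have "\<dots> = (\<Sum>a\<in>Poly_Mapping.keys p. \<Sum>b\<in>Poly_Mapping.keys q. Poly_Mapping.single (a + b) (Poly_Mapping.lookup p a * Poly_Mapping.lookup q b))"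
    by (simp add: sum_product mult_single)
  finally have "peval (p * q) x =
      (\<Sum>a\<in>Poly_Mapping.keys p. \<Sum>b\<in>Poly_Mapping.keys q. (Poly_Mapping.lookup p a * mon_eval x a) * (Poly_Mapping.lookup q b * mon_eval x b))"
    by (simp add: peval_sum peval_single mon_eval_add mult_ac)
  also have "\<dots> = peval p x * peval q x"
    by (simp add: peval_eq_sum[OF finite_keys order_refl] sum_product)
  finally show ?thesis .
qed

lemma mon_eval_0 [simp]: "mon_eval x 0 = 1"
  by (simp add: mon_eval_def)

lemma peval_const [simp]: "peval (const c) x = c"
  by (simp add: const_def peval_single)

lemma const_1 [simp]: "const 1 = 1"
  by (simp add: const_def)

lemma const_add: "const (a + b) = const a + const b"
  by (simp add: const_def single_add)

lemma const_mult: "const (a * b) = const a * const b"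
  by (simp add: const_def mult_single)

lemma of_int_eq_const: "of_int k = const (of_int k)"
  by (simp add: const_def)

lemma peval_one [simp]: "peval 1 x = 1"
  by (simp flip: const_1)

lemma peval_prod: "peval (prod f A) x = (\<Prod>a\<in>A. peval (f a) x)"
  by (induction A rule: infinite_finite_induct) simp_all

lemma peval_of_int [simp]: "peval (of_int k) x = of_int k"
  by (simp add: of_int_eq_const)

lemma lookup_const_mult: "Poly_Mapping.lookup (const c * p) m = c * Poly_Mapping.lookup p m"
  unfolding const_def mult_map_scale_conv_mult[symmetric]
  by (simp add: Poly_Mapping.map.rep_eq when_def)

lemma peval_scale:
  assumes "homogeneous d p"
  shows "peval p (t *s x) = t ^ d * peval p x"
proof -
  have "Poly_Mapping.lookup p m * mon_eval (t *s x) m = t ^ d * (Poly_Mapping.lookup p m * mon_eval x m)" for m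
  proof (cases "Poly_Mapping.lookup p m = 0")
    case False
    then have "mdeg m = d" using assms by (simp add: homogeneous_iff)
    then have "t ^ d = (\<Prod>v\<in>UNIV. t ^ Poly_Mapping.lookup m v)" by (auto simp: mdeg_def power_sum)
    then have "mon_eval (t *s x) m = t ^ d * mon_eval x m"
      by (simp add: mon_eval_def power_mult_distrib prod.distrib)
    then show ?thesis by simp
  qed simp
  then show ?thesis
    unfolding peval_eq_sum[OF finite_keys order_refl] sum_distrib_left by (rule sum.cong[OF refl])
qed

lemma homogeneous_add: "homogeneous d p \<Longrightarrow> homogeneous d q \<Longrightarrow> homogeneous d (p + q)"
  unfolding homogeneous_iff by (metis add_0 lookup_add)

lemma homogeneous_zero: "homogeneous d 0"
  by (simp add: homogeneous_iff)

lemma homogeneous_sum: "(\<And>a. a \<in> A \<Longrightarrow> homogeneous d (f a)) \<Longrightarrow> homogeneous d (sum f A)"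
  by (induction A rule: infinite_finite_induct) (simp_all add: homogeneous_zero homogeneous_add)

lemma homogeneous_mult:
  assumes "homogeneous d p" "homogeneous e q"
  shows "homogeneous (d + e) (p * q)"
  unfolding homogeneous_iff
proof (intro allI impI)
  fix m assume "Poly_Mapping.lookup (p * q) m \<noteq> 0"
  then have "m \<in> Poly_Mapping.keys (p * q)" by (simp add: in_keys_iff)
  then obtain a b where "m = a + b" "a \<in> Poly_Mapping.keys p" "b \<in> Poly_Mapping.keys q"
    using keys_mult[of p q] by blast
  with assms show "mdeg m = d + e" by (simp add: homogeneous_iff mdeg_add in_keys_iff)
qed

lemma homogeneous_const: "homogeneous 0 (const c)"
  by (auto simp: homogeneous_iff const_def lookup_single when_def mdeg_def)

lemma homogeneous_pvar: "homogeneous 1 (pvar v)"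
proof -
  have "mdeg m = 1" if "Poly_Mapping.single v 1 = m" for m
    using mdeg_single[of v 1] that by simp
  then show ?thesis by (simp add: homogeneous_iff pvar_def lookup_single when_def)
qed

lemma homogeneous_prod:
  assumes "\<And>a. a \<in> A \<Longrightarrow> homogeneous 1 (f a)"
  shows "homogeneous (card A) (prod f A)"
  using assms
proof (induction A rule: infinite_finite_induct)
  case (insert a A)
  then have "homogeneous (1 + card A) (f a * prod f A)"
    by (intro homogeneous_mult) simp_all
  with insert show ?case by simp
qed (simp_all add: homogeneous_const flip: const_1)

text \<open>Lists the variables of a monomial with multiplicity, so that monomials can later be
  spelled by words of indices.\<close>

lemma mdeg_decompose:
  assumes "mdeg m = d"
  shows "\<exists>v. m = (\<Sum>a<d. Poly_Mapping.single (v a) 1)"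
  using assms
proof (induction d arbitrary: m)
  case 0
  then show ?case by (auto simp: mdeg_def intro: poly_mapping_eqI)
next
  case (Suc d)
  then obtain w where w: "Poly_Mapping.lookup m w \<noteq> 0" unfolding mdeg_def
    by (metis Zero_not_Suc sum.neutral)
  define m' where "m' = m - Poly_Mapping.single w 1"
  have m: "m = m' + Poly_Mapping.single w 1"
    using w by (intro poly_mapping_eqI) (auto simp: m'_def lookup_add lookup_minus lookup_single when_def)
  with Suc.prems have "mdeg m' = d" by (simp add: mdeg_add mdeg_single)
  from Suc.IH[OF this] obtain v where v: "m' = (\<Sum>a<d. Poly_Mapping.single (v a) 1)" by blast
  show ?case
    by (rule exI[of _ "v(d := w)"]) (simp add: m v)
qed

lemma monomial_sum_single:
  "finite A \<Longrightarrow> monomial (\<Sum>a\<in>A. Poly_Mapping.single (v a) 1) = (\<Prod>a\<in>A. pvar (v a))"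
proof (induction A rule: finite_induct)
  case (insert a A)
  have "monomial (Poly_Mapping.single (v a) 1 + m) = pvar (v a) * monomial m" for m
    by (simp add: monomial_def pvar_def mult_single)
  with insert show ?case by simp
qed (simp add: monomial_def)

text \<open>Makes the bound on the number of roots available: vanishing at infinitely many points of
  a line extends to the whole line.\<close>

lemma poly_along_line: "\<exists>q. \<forall>t. poly q t = peval p (t *s x + y)"
proof
  show "\<forall>t. poly (\<Sum>m\<in>Poly_Mapping.keys p. [:Poly_Mapping.lookup p m:] * (\<Prod>v\<in>UNIV. [:y $ v, x $ v:] ^ Poly_Mapping.lookup m v)) t
          = peval p (t *s x + y)"
    by (simp add: poly_sum poly_prod peval_def algebra_simps)
qed

section \<open>Closure properties of generated ideals\<close>

lemma ideal_generated_base: "p \<in> S \<Longrightarrow> p \<in> ideal_generated S"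
  unfolding ideal_generated_def by (rule module.span_base[OF module_mult])

lemma ideal_generated_0: "0 \<in> ideal_generated S"
  unfolding ideal_generated_def by (rule module.span_zero[OF module_mult])

lemma ideal_generated_add:
  "p \<in> ideal_generated S \<Longrightarrow> q \<in> ideal_generated S \<Longrightarrow> p + q \<in> ideal_generated S"
  unfolding ideal_generated_def by (rule module.span_add[OF module_mult])

lemma ideal_generated_mult: "p \<in> ideal_generated S \<Longrightarrow> q * p \<in> ideal_generated S"
  unfolding ideal_generated_def by (rule module.span_scale[OF module_mult])

lemma ideal_generated_sum:
  "(\<And>a. a \<in> A \<Longrightarrow> f a \<in> ideal_generated S) \<Longrightarrow> sum f A \<in> ideal_generated S"
  unfolding ideal_generated_def by (rule module.span_sum[OF module_mult])

lemma ideal_generated_minimal: "S \<subseteq> ideal_generated S' \<Longrightarrow> ideal_generated S \<subseteq> ideal_generated S'"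
  unfolding ideal_generated_def
  by (rule module.span_minimal[OF module_mult]) (auto intro: module.subspace_span[OF module_mult])

section \<open>Simultaneous diagonalization of real pencils\<close>

text \<open>At \<open>x + s *\<^sub>R f x\<close> the quadratic form equals
  \<open>2 * s * a + s^2 * b\<close> with \<open>a = f x \<bullet> f x\<close>; for positive
  \<open>a\<close> this would be negative at small negative \<open>s\<close>.\<close>

lemma psd_inner_eq_0D:
  fixes f :: "'a::euclidean_space \<Rightarrow> 'a"
  assumes "linear f" and sym: "\<And>x y. f x \<bullet> y = x \<bullet> f y"
    and psd: "\<And>x. x \<bullet> f x \<ge> 0" and "x \<bullet> f x = 0"
  shows "f x = 0"
proof -
  interpret linear f by fact
  define a where "a = f x \<bullet> f x"
  define b where "b = f x \<bullet> f (f x)"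
  have b: "b \<ge> 0" using psd[of "f x"] by (simp add: b_def)
  \<comment> \<open>Any sufficiently small negative multiple of \<open>a\<close> would do; the
    \<open>+ 1\<close> keeps the denominator positive when \<open>b = 0\<close>.\<close>
  define s where "s = - a / (b + 1)"
  have "x \<bullet> f (f x) = a" using sym[of x "f x"] by (simp add: a_def)
  then have "0 \<le> 2 * s * a + s^2 * b"
    using psd[of "x + s *\<^sub>R f x"] assms(4)
    by (simp add: add scale inner_add_left inner_add_right a_def b_def power2_eq_square algebra_simps)
  then have "0 \<le> (2 * s * a + s^2 * b) * (b + 1)^2" by simp
  also have "\<dots> = 2 * a * (b + 1) * (s * (b + 1)) + b * (s * (b + 1))^2"
    by (simp add: power2_eq_square algebra_simps)
  also have "s * (b + 1) = - a" using b by (simp add: s_def)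
  finally have "a^2 * (b + 2) \<le> 0" by (simp add: power2_eq_square algebra_simps)
  then have "a = 0" using b
    by (smt (verit) mult_pos_pos zero_less_power2)
  then show ?thesis by (simp add: a_def)
qed

text \<open>
  The pencil is split by peeling off a maximiser \<open>w\<close> of the Rayleigh quotient of \<open>h\<close> with
  respect to \<open>f\<close>: the form \<open>\<tau> f - h\<close> is positive semidefinite and vanishes at \<open>w\<close>, so
  \<open>h w = \<tau> f w\<close>.
\<close>
lemma psd_pencil_diagonalization:
  fixes f h :: "'a::euclidean_space \<Rightarrow> 'a"
  assumes "linear f" "linear h"
    and "\<And>x y. f x \<bullet> y = x \<bullet> f y" "\<And>x y. h x \<bullet> y = x \<bullet> h y"
    and "\<And>x. x \<bullet> f x \<ge> 0" "\<And>x. f x = 0 \<Longrightarrow> h x = 0"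
    and "dim (range f) \<le> r"
  shows "\<exists>z \<tau>. \<forall>x. f x = (\<Sum>i<r. (z i \<bullet> x) *\<^sub>R z i) \<and> h x = (\<Sum>i<r. (\<tau> i * (z i \<bullet> x)) *\<^sub>R z i)"
  using assms
proof (induction r arbitrary: f h)
  case 0
  then have "range f \<subseteq> {0}" by (simp add: dim_eq_0)
  then have "f x = 0" for x by auto
  with 0 show ?case by auto
next
  case (Suc r f h)
  interpret f: linear f by fact
  interpret h: linear h by fact
  note sym = Suc.prems(3) and hsym = Suc.prems(4) and psd = Suc.prems(5) and ker = Suc.prems(6)
  show ?case
  proof (cases "\<forall>x. f x = 0")
    case True
    with ker show ?thesis by (intro exI[of _ "\<lambda>_. 0"]) auto
  next
    case False
    then obtain x0 where x0: "f x0 \<noteq> 0" by blast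
    define W where "W = range f"
    have subW: "subspace W" unfolding W_def using linear_subspace_image[OF \<open>linear f\<close>, of UNIV] by simp
    \<comment> \<open>The kernel of a symmetric map is the orthogonal complement of its range.
      Modulo this kernel, on which \<open>h\<close> vanishes too, every vector lies in
      \<open>W\<close>, where the form of \<open>f\<close> is definite and the Rayleigh quotient
      makes sense.\<close>
    have split: "\<exists>y\<in>W. f (x - y) = 0" for x
    proof -
      obtain y z where yz: "y \<in> span W" "\<And>w. w \<in> span W \<Longrightarrow> orthogonal z w" "x = y + z"
        using orthogonal_subspace_decomp_exists[of W x] by metis
      have "f z \<bullet> f z = z \<bullet> f (f z)" by (simp add: sym)
      also have "\<dots> = 0" using yz(2)[of "f (f z)"] by (simp add: orthogonal_def W_def span_base)
      finally have "f z = 0" by simp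
      moreover have "y \<in> W" using yz(1) subW by (metis span_eq_iff)
      ultimately show ?thesis using yz(3) by (intro bexI[of _ y]) simp_all
    qed
    have pos: "x \<bullet> f x > 0" if "x \<in> W" "x \<noteq> 0" for x
    proof (rule ccontr)
      assume "\<not> ?thesis"
      then have "x \<bullet> f x = 0" using psd[of x] by linarith
      then have "f x = 0" using psd_inner_eq_0D[OF \<open>linear f\<close> sym psd] by blast
      moreover obtain y where "x = f y" using \<open>x \<in> W\<close> by (auto simp: W_def)
      ultimately have "x \<bullet> x = 0" using sym[of y x] by simp
      with that show False by simp
    qed
    define S where "S = W \<inter> sphere 0 1"
    have "compact S" unfolding S_def using closed_subspace[OF subW] by (simp add: closed_Int_compact)
    moreover have "(1 / norm (f x0)) *\<^sub>R f x0 \<in> S"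
      using x0 subW by (simp add: S_def W_def subspace_scale)
    moreover have "continuous_on S (\<lambda>x. (x \<bullet> h x) / (x \<bullet> f x))"
    proof (intro continuous_intros)
      show "continuous_on S f" "continuous_on S h"
        using \<open>linear f\<close> \<open>linear h\<close> by (simp_all add: linear_continuous_on linear_conv_bounded_linear)
      show "\<forall>x\<in>S. x \<bullet> f x \<noteq> 0" using pos by (force simp: S_def)
    qed
    ultimately obtain w where w: "w \<in> S" "\<And>y. y \<in> S \<Longrightarrow> (y \<bullet> h y) / (y \<bullet> f y) \<le> (w \<bullet> h w) / (w \<bullet> f w)"
      using continuous_attains_sup[of S "\<lambda>x. (x \<bullet> h x) / (x \<bullet> f x)"] by auto
    define t where "t = (w \<bullet> h w) / (w \<bullet> f w)"
    define \<beta> where "\<beta> = w \<bullet> f w"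
    have wW: "w \<in> W" and w0: "w \<noteq> 0" using w(1) by (auto simp: S_def)
    have \<beta>: "\<beta> > 0" unfolding \<beta>_def using pos wW w0 .
    have onW: "x \<bullet> h x \<le> t * (x \<bullet> f x)" if "x \<in> W" for x
    proof (cases "x = 0")
      case False
      have "(1 / norm x) *\<^sub>R x \<in> S" using False that subW by (simp add: S_def subspace_scale)
      from w(2)[OF this] have "(x \<bullet> h x) / (x \<bullet> f x) \<le> t"
        using False by (simp add: f.scale h.scale t_def)
      then show ?thesis using pos[OF that False] by (simp add: field_simps)
    qed simp
    define k where "k x = t *\<^sub>R f x - h x" for x
    have "linear k" unfolding k_def
      by (intro linear_compose_sub linear_compose_scale_right \<open>linear f\<close> \<open>linear h\<close>)
    moreover have "k x \<bullet> y = x \<bullet> k y" for x y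
      by (simp add: k_def inner_diff_left inner_diff_right sym hsym)
    moreover have "x \<bullet> k x \<ge> 0" for x
    proof -
      obtain y where y: "y \<in> W" "f (x - y) = 0" using split by blast
      then have eq: "f x = f y" "h x = h y" using ker[OF y(2)] by (simp_all add: f.diff h.diff)
      have "x \<bullet> f x = y \<bullet> f y" "x \<bullet> h x = y \<bullet> h y"
        using sym[of x y] hsym[of x y] eq by (simp_all add: inner_commute)
      then show ?thesis using onW[OF y(1)] by (simp add: k_def inner_diff_right)
    qed
    moreover have "w \<bullet> k w = 0" using \<beta> by (simp add: k_def inner_diff_right t_def \<beta>_def)
    ultimately have "k w = 0" by (rule psd_inner_eq_0D)
    then have hw: "h w = t *\<^sub>R f w" by (simp add: k_def)
    \<comment> \<open>Scaled so that \<open>(b \<bullet> w) *\<^sub>R b = f w\<close>: subtracting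
      the square of \<open>b\<close> from \<open>f\<close>, and \<open>t\<close> times it from
      \<open>h\<close>, puts \<open>w\<close> into both kernels.\<close>
    define b where "b = (1 / sqrt \<beta>) *\<^sub>R f w"
    have bb: "b \<bullet> w = sqrt \<beta>" using \<beta>
      by (simp add: b_def sym \<beta>_def real_div_sqrt)
    have fw: "f w = sqrt \<beta> *\<^sub>R b" using \<beta> by (simp add: b_def)
    define f' where "f' x = f x - (b \<bullet> x) *\<^sub>R b" for x
    define h' where "h' x = h x - (t * (b \<bullet> x)) *\<^sub>R b" for x
    have lin: "linear f'" "linear h'" unfolding f'_def h'_def
      by (auto intro!: linearI simp: f.add h.add f.scale h.scale inner_add_right algebra_simps)
    have f'w: "f' w = 0" by (simp add: f'_def bb fw)
    have h'w: "h' w = 0" by (simp add: h'_def bb hw fw)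
    have bx: "b \<bullet> x = (w \<bullet> f x) / sqrt \<beta>" for x by (simp add: b_def sym)
    have sym': "f' x \<bullet> y = x \<bullet> f' y" for x y
      by (simp add: f'_def inner_diff_left inner_diff_right sym inner_commute[of b])
    have hsym': "h' x \<bullet> y = x \<bullet> h' y" for x y
      by (simp add: h'_def inner_diff_left inner_diff_right hsym inner_commute[of b])
    have psd': "x \<bullet> f' x \<ge> 0" for x
    proof -
      \<comment> \<open>With this \<open>c\<close> the vector \<open>x - c *\<^sub>R w\<close> is
        orthogonal to \<open>b\<close>, so \<open>f'\<close> and \<open>f\<close> agree there, while
        \<open>f' w = 0\<close> hides the shift from \<open>f'\<close>.\<close>
      define c where "c = (b \<bullet> x) / sqrt \<beta>"
      have c: "b \<bullet> x = c * sqrt \<beta>" using \<beta> by (simp add: c_def)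
      have "b \<bullet> (x - c *\<^sub>R w) = 0" by (simp add: inner_diff_right bb c)
      then have "f' (x - c *\<^sub>R w) = f (x - c *\<^sub>R w)" by (simp add: f'_def)
      moreover have "f' (x - c *\<^sub>R w) = f' x"
        using f'w by (simp add: linear_diff[OF lin(1)] linear_scale[OF lin(1)])
      moreover have "(x - c *\<^sub>R w) \<bullet> f' x = x \<bullet> f' x"
        using sym'[of w x] f'w by (simp add: inner_diff_left)
      ultimately show ?thesis using psd[of "x - c *\<^sub>R w"] by simp
    qed
    have ker': "h' x = 0" if "f' x = 0" for x
    proof -
      define c where "c = (b \<bullet> x) / sqrt \<beta>"
      have c: "b \<bullet> x = c * sqrt \<beta>" using \<beta> by (simp add: c_def)
      have b0: "b \<bullet> (x - c *\<^sub>R w) = 0" by (simp add: inner_diff_right bb c)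
      have "f (x - c *\<^sub>R w) = 0"
        using that b0 f'w linear_diff[OF lin(1), of x "c *\<^sub>R w"] linear_scale[OF lin(1), of c w]
        by (simp add: f'_def)
      then have "h (x - c *\<^sub>R w) = 0" by (rule ker)
      then have "h' (x - c *\<^sub>R w) = 0" using b0 by (simp add: h'_def)
      then show ?thesis using h'w by (simp add: linear_diff[OF lin(2)] linear_scale[OF lin(2)])
    qed
    have "range f' \<subseteq> range f"
    proof
      fix y assume "y \<in> range f'"
      then obtain x where "y = f x - (b \<bullet> x) *\<^sub>R b" by (auto simp: f'_def)
      then have "y = f (x - ((b \<bullet> x) / sqrt \<beta>) *\<^sub>R w)" by (simp add: b_def f.diff f.scale)
      then show "y \<in> range f" by blast
    qed
    \<comment> \<open>By symmetry and \<open>f' w = 0\<close>, all values of \<open>f'\<close> are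
      orthogonal to \<open>w\<close>, but \<open>w \<bullet> f w\<close> is positive. Hence the rank
      drops.\<close>
    moreover have "f w \<notin> range f'"
    proof
      assume "f w \<in> range f'"
      then obtain x where "f w = f' x" by auto
      then have "w \<bullet> f w = f' w \<bullet> x" using sym'[of w x] by simp
      with f'w \<beta> show False by (simp add: \<beta>_def)
    qed
    ultimately have "range f' \<subset> range f" by blast
    moreover have "subspace (range f')" using linear_subspace_image[OF lin(1)] by simp
    ultimately have "span (range f') \<subset> span (range f)"
      using subW by (metis span_eq_iff W_def)
    then have "dim (range f') < dim (range f)" by (rule dim_psubset)
    then have "dim (range f') \<le> r" using Suc.prems(7) by simp
    from Suc.IH[OF lin sym' hsym' psd' ker' this] obtain z \<tau> where
      z: "\<And>x. f' x = (\<Sum>i<r. (z i \<bullet> x) *\<^sub>R z i)" "\<And>x. h' x = (\<Sum>i<r. (\<tau> i * (z i \<bullet> x)) *\<^sub>R z i)"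
      by blast
    show ?thesis
    proof (intro exI allI conjI)
      fix x
      show "f x = (\<Sum>i<Suc r. ((z(r := b)) i \<bullet> x) *\<^sub>R (z(r := b)) i)"
        using z(1)[of x] by (simp add: f'_def algebra_simps)
      show "h x = (\<Sum>i<Suc r. ((\<tau>(r := t)) i * ((z(r := b)) i \<bullet> x)) *\<^sub>R (z(r := b)) i)"
        using z(2)[of x] by (simp add: h'_def algebra_simps)
    qed
  qed
qed

section \<open>Tensors annihilated by maps of bounded rank\<close>

text \<open>The number \<open>k\<close> counts steps, so the chain has the \<open>k + 1\<close>
  positions \<open>e 0, ..., e k\<close>; a chain with \<open>r\<close> steps supplies the
  \<open>r + 1\<close> positions to alternate.\<close>

definition desc_chain :: "(nat \<Rightarrow> nat) \<Rightarrow> (nat \<Rightarrow> nat) \<Rightarrow> nat \<Rightarrow> bool" where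
  "desc_chain x e k \<longleftrightarrow> (\<forall>i<k. e i < e (Suc i) \<and> x (e (Suc i)) < x (e i))"

lemma desc_chainD:
  assumes "desc_chain x e k" "i < j" "j \<le> k"
  shows "e i < e j" "x (e j) < x (e i)"
proof -
  have "e i < e j \<and> x (e j) < x (e i)"
    using \<open>i < j\<close> \<open>j \<le> k\<close>
  proof (induction j)
    case (Suc j)
    have *: "e j < e (Suc j)" "x (e (Suc j)) < x (e j)"
      using assms(1) Suc.prems by (auto simp: desc_chain_def)
    show ?case
    proof (cases "i = j")
      case False
      with Suc show ?thesis using * by auto
    qed (use * in simp)
  qed simp
  then show "e i < e j" "x (e j) < x (e i)" by auto
qed

text \<open>The colour of a position is the length of the longest strictly decreasing chain ending there.\<close>
lemma colouring_or_desc_chain: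
  "(\<exists>c. (\<forall>a<m. c a < r) \<and> (\<forall>b a. b < a \<and> a < m \<and> x a < x b \<longrightarrow> c b < c a)) \<or>
   (\<exists>e. desc_chain x e r \<and> e r < m)"
proof (rule disjCI)
  assume none: "\<nexists>e. desc_chain x e r \<and> e r < m"
  define L where "L a = {k. \<exists>e. desc_chain x e k \<and> e k = a}" for a
  define c where "c a = Max (L a)" for a
  have len: "k \<le> e k" if "desc_chain x e k" for e k
  proof -
    have "i \<le> e i" if "i \<le> k" for i
      using that \<open>desc_chain x e k\<close>
      by (induction i) (auto simp: desc_chain_def Suc_le_eq intro: le_less_trans)
    then show ?thesis by simp
  qed
  have "L a \<subseteq> {..a}" for a using len by (auto simp: L_def)
  then have fin: "finite (L a)" for a by (rule finite_subset) simp
  have "0 \<in> L a" for a unfolding L_def desc_chain_def by auto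
  then have ne: "L a \<noteq> {}" for a by blast
  have cL: "c a \<in> L a" for a unfolding c_def by (rule Max_in[OF fin ne])
  have "c a < r" if "a < m" for a
  proof (rule ccontr)
    assume "\<not> c a < r"
    then have r: "r \<le> c a" by simp
    obtain e where e: "desc_chain x e (c a)" "e (c a) = a" using cL[of a] by (auto simp: L_def)
    \<comment> \<open>Cutting the chain after \<open>r\<close> steps leaves a chain that ends no
      later than \<open>a\<close>.\<close>
    have "desc_chain x e r" using e(1) r by (auto simp: desc_chain_def)
    moreover have "e r \<le> a" using r e desc_chainD(1)[OF e(1), of r "c a"] by (cases "r = c a") auto
    ultimately show False using none that by auto
  qed
  moreover have "c b < c a" if "b < a" "a < m" "x a < x b" for a b
  proof -
    obtain e where e: "desc_chain x e (c b)" "e (c b) = b" using cL[of b] by (auto simp: L_def)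
    have "desc_chain x (e(Suc (c b) := a)) (Suc (c b))"
      using e that by (auto simp: desc_chain_def less_Suc_eq)
    then have "Suc (c b) \<in> L a" unfolding L_def by force
    then show ?thesis using Max_ge[OF fin, of "Suc (c b)" a] by (simp add: c_def)
  qed
  ultimately show "\<exists>c. (\<forall>a<m. c a < r) \<and> (\<forall>b a. b < a \<and> a < m \<and> x a < x b \<longrightarrow> c b < c a)"
    by blast
qed

section \<open>Lexicographic order of words and rearrangement of their letters\<close>

primrec lexval :: "nat \<Rightarrow> (nat \<Rightarrow> nat) \<Rightarrow> nat \<Rightarrow> nat" where
  "lexval D x 0 = 0"
| "lexval D x (Suc j) = lexval D x j * D + x j"

lemma lexval_cong: "(\<And>b. b < j \<Longrightarrow> x b = y b) \<Longrightarrow> lexval D x j = lexval D y j"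
  by (induction j) auto

text \<open>\<open>lexval\<close> reads a word as a number in base \<open>D\<close>, most
  significant letter first. A deficit of at least one is worth at least \<open>D\<close> at the next
  step, more than a single digit of \<open>x\<close> can make up.\<close>

lemma lexval_less:
  assumes "a < j" "\<And>b. b < a \<Longrightarrow> x b = y b" "x a < y a" "\<And>b. x b < D"
  shows "lexval D x j < lexval D y j"
  using assms(1)
proof (induction j)
  case (Suc j)
  show ?case
  proof (cases "a = j")
    case True
    then show ?thesis using lexval_cong[of j x y D] assms by simp
  next
    case False
    with Suc have "Suc (lexval D x j) \<le> lexval D y j" by simp
    then have "Suc (lexval D x j) * D \<le> lexval D y j * D" by (rule mult_le_mono1)
    then show ?thesis using assms(4)[of j] by simp
  qed
qed simp

lemma digits_unique:
  fixes f g :: "nat \<Rightarrow> nat"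
  assumes "\<And>k. f k < D" "\<And>k. g k < D"
    and "(\<Sum>k<K. f k * D ^ k) = (\<Sum>k<K. g k * D ^ k)" "k < K"
  shows "f k = g k"
  using assms
proof (induction K arbitrary: f g k)
  case (Suc K)
  have D: "D > 0" using Suc.prems(1)[of 0] by simp
  have *: "(\<Sum>k<Suc K. f k * D ^ k) = f 0 + D * (\<Sum>k<K. f (Suc k) * D ^ k)" for f
    by (subst sum.lessThan_Suc_shift) (simp add: sum_distrib_left mult_ac)
  have eq: "f 0 + D * (\<Sum>k<K. f (Suc k) * D ^ k) = g 0 + D * (\<Sum>k<K. g (Suc k) * D ^ k)"
    using Suc.prems(3) by (simp only: *)
  then have "(f 0 + D * (\<Sum>k<K. f (Suc k) * D ^ k)) mod D = (g 0 + D * (\<Sum>k<K. g (Suc k) * D ^ k)) mod D"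
    by simp
  then have 0: "f 0 = g 0" using Suc.prems(1,2) by simp
  with eq D have "(\<Sum>k<K. f (Suc k) * D ^ k) = (\<Sum>k<K. g (Suc k) * D ^ k)" by simp
  from Suc.IH[OF Suc.prems(1,2) this] 0 Suc.prems(4) show ?case by (cases k) auto
qed simp

text \<open>The permutation acts on indices into the list \<open>e\<close> rather than on positions,
  so that alternating sums run over permutations of \<open>{0..<s}\<close> and match the Leibniz
  formula for a determinant.\<close>

definition permute_letters :: "nat \<Rightarrow> (nat \<Rightarrow> nat) \<Rightarrow> (nat \<Rightarrow> nat) \<Rightarrow> (nat \<Rightarrow> 'a) \<Rightarrow> nat \<Rightarrow> 'a" where
  "permute_letters s e p w = (\<lambda>b. if b \<in> e ` {0..<s} then w (e (p (inv_into {0..<s} e b))) else w b)"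

lemma permute_letters_at:
  "inj_on e {0..<s} \<Longrightarrow> i < s \<Longrightarrow> permute_letters s e p w (e i) = w (e (p i))"
  by (simp add: permute_letters_def)

lemma permute_letters_other: "b \<notin> e ` {0..<s} \<Longrightarrow> permute_letters s e p w b = w b"
  by (simp add: permute_letters_def)

lemma permute_letters_id: "inj_on e {0..<s} \<Longrightarrow> permute_letters s e id w = w"
  by (auto simp: permute_letters_def fun_eq_iff)

lemma permute_letters_in_words:
  assumes "inj_on e {0..<s}" "e ` {0..<s} \<subseteq> A" "w \<in> A \<rightarrow>\<^sub>E UNIV"
  shows "permute_letters s e p w \<in> A \<rightarrow>\<^sub>E UNIV"
  using assms by (auto simp: permute_letters_def PiE_iff extensional_def)

lemma permute_letters_transpose:
  assumes "inj_on e {0..<s}" "i < s" "j < s"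
  shows "permute_letters s e (p \<circ> transpose i j) w = permute_letters s e p w \<circ> transpose (e i) (e j)"
proof
  fix b
  show "permute_letters s e (p \<circ> transpose i j) w b = (permute_letters s e p w \<circ> transpose (e i) (e j)) b"
  proof (cases "b \<in> e ` {0..<s}")
    case True
    then obtain k where k: "k < s" "b = e k" by auto
    have "e k = e i \<longleftrightarrow> k = i" "e k = e j \<longleftrightarrow> k = j"
      using assms k inj_on_eq_iff[OF assms(1)] by auto
    then have 1: "transpose (e i) (e j) (e k) = e (transpose i j k)"
      unfolding transpose_def by simp
    have 2: "transpose i j k < s" using assms(2,3) k(1) unfolding transpose_def by simp
    show ?thesis
      unfolding k(2) comp_def 1 permute_letters_at[OF assms(1) k(1)] permute_letters_at[OF assms(1) 2] ..
  next
    case False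
    then have "b \<noteq> e i" "b \<noteq> e j" using assms(2,3) by auto
    then have "transpose (e i) (e j) b = b" by (rule transpose_apply_other)
    with False show ?thesis by (simp add: permute_letters_other)
  qed
qed

text \<open>Composition with the transposition pairs permutations of opposite sign. Whether being
  one's own negative forces zero depends on the module, so that conclusion is left to each
  application.\<close>

lemma (in Modules.module) alternating_sum_eq_uminus:
  fixes s :: nat and X :: "(nat \<Rightarrow> nat) \<Rightarrow> 'b"
  assumes "i < s" "j < s" "i \<noteq> j" "\<And>p. X (p \<circ> transpose i j) = X p"
  shows "(\<Sum>p | p permutes {0..<s}. of_int (sign p) *s X p) = - (\<Sum>p | p permutes {0..<s}. of_int (sign p) *s X p)"
proof -
  have t: "transpose i j permutes {0..<s}" by (rule permutes_swap_id) (use assms(1,2) in auto)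
  have "(\<Sum>p | p permutes {0..<s}. of_int (sign p) *s X p)
      = (\<Sum>p | p permutes {0..<s}. of_int (sign (p \<circ> transpose i j)) *s X (p \<circ> transpose i j))"
    by (rule sum_permutations_compose_right[OF t])
  also have "\<dots> = (\<Sum>p | p permutes {0..<s}. - (of_int (sign p) *s X p))"
  proof (rule sum.cong[OF refl])
    fix p assume "p \<in> {p. p permutes {0..<s}}"
    then have "permutation p" using permutes_imp_permutation[of "{0..<s}" p] by simp
    then have "sign (p \<circ> transpose i j) = - sign p"
      using assms(3) by (simp add: sign_compose permutation_swap_id sign_swap_id)
    then show "of_int (sign (p \<circ> transpose i j)) *s X (p \<circ> transpose i j) = - (of_int (sign p) *s X p)"
      by (simp add: assms(4))
  qed
  finally show ?thesis by (simp add: sum_negf)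
qed

text \<open>The least index \<open>a\<close> moved by \<open>p\<close> has \<open>a < p a\<close>,
  since smaller indices are fixed. So the first position affected receives a letter from further
  along the chain, which is smaller.\<close>

lemma permute_letters_lexval_less:
  fixes h :: "'a \<Rightarrow> nat"
  assumes chain: "desc_chain (h \<circ> w) e r" and "e r < m"
    and p: "p permutes {0..<Suc r}" "p \<noteq> id" and D: "\<And>a. h a < D"
  shows "lexval D (h \<circ> permute_letters (Suc r) e p w) m < lexval D (h \<circ> w) m"
proof -
  have smono: "e i < e j" if "i < j" "j < Suc r" for i j
    using desc_chainD(1)[OF chain, of i j] that by simp
  have inj: "inj_on e {0..<Suc r}"
    using smono by (intro linorder_inj_onI) (auto simp: less_imp_neq)
  define a where "a = (LEAST i. p i \<noteq> i)"
  have "\<exists>i. p i \<noteq> i" using p(2) by (auto simp: fun_eq_iff)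
  then have a: "p a \<noteq> a" unfolding a_def by (rule LeastI_ex)
  have below: "p i = i" if "i < a" for i using not_less_Least[of i "\<lambda>i. p i \<noteq> i"] that a_def by blast
  have a_r: "a < Suc r" using a p(1) by (meson atLeastLessThan_iff not_le permutes_not_in zero_le)
  then have pa_r: "p a < Suc r" using permutes_in_image[OF p(1), of a] by simp
  have "\<not> p a < a"
  proof
    assume "p a < a"
    then have "p (p a) = p a" by (rule below)
    then show False using a permutes_inj[OF p(1)] by (simp add: inj_def)
  qed
  with a have a_pa: "a < p a" by simp
  show ?thesis
  proof (rule lexval_less)
    show "e a < m" using smono[of a r] a_r \<open>e r < m\<close> by (cases "a = r") auto
    show "(h \<circ> permute_letters (Suc r) e p w) (e a) < (h \<circ> w) (e a)"
      using desc_chainD(2)[OF chain a_pa] pa_r a_r by (simp add: permute_letters_at[OF inj])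
    show "(h \<circ> permute_letters (Suc r) e p w) b = (h \<circ> w) b" if "b < e a" for b
    proof (cases "b \<in> e ` {0..<Suc r}")
      case True
      then obtain i where i: "i < Suc r" "b = e i" by auto
      have "i < a"
      proof (rule ccontr)
        assume "\<not> i < a"
        then have "e a \<le> e i" using smono[of a i] i by (cases "i = a") auto
        with that i show False by simp
      qed
      with i show ?thesis by (simp add: permute_letters_at[OF inj] below)
    qed (simp add: permute_letters_other)
    show "(h \<circ> permute_letters (Suc r) e p w) b < D" for b using D by simp
  qed
qed

section \<open>Separating words by a Kronecker substitution\<close>

lemma first_difference:
  assumes "w \<in> {..<m::nat} \<rightarrow>\<^sub>E UNIV" "w' \<in> {..<m} \<rightarrow>\<^sub>E UNIV" "w \<noteq> w'"
  obtains a where "a < m" "w a \<noteq> w' a" "\<And>b. b < a \<Longrightarrow> w b = w' b"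
proof -
  define a where "a = (LEAST i. w i \<noteq> w' i)"
  have "\<exists>i. w i \<noteq> w' i" using assms(3) by (auto simp: fun_eq_iff)
  then have "w a \<noteq> w' a" unfolding a_def by (rule LeastI_ex)
  moreover from this have "a < m" using assms(1,2) by (metis PiE_arb lessThan_iff)
  moreover have "w b = w' b" if "b < a" for b
    using not_less_Least[of b "\<lambda>i. w i \<noteq> w' i"] that a_def by blast
  ultimately show thesis using that by blast
qed

lemma lexval_inj:
  fixes h :: "'a \<Rightarrow> nat"
  assumes "inj h" "\<And>a. h a < D" "w \<in> {..<m} \<rightarrow>\<^sub>E UNIV" "w' \<in> {..<m} \<rightarrow>\<^sub>E UNIV"
    and "lexval D (h \<circ> w) m = lexval D (h \<circ> w') m"
  shows "w = w'"
proof (rule ccontr)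
  assume "w \<noteq> w'"
  with assms obtain a where a: "a < m" "w a \<noteq> w' a" "\<And>b. b < a \<Longrightarrow> w b = w' b"
    by (metis first_difference)
  then have "h (w a) \<noteq> h (w' a)" using \<open>inj h\<close> by (simp add: inj_eq)
  then consider "h (w a) < h (w' a)" | "h (w' a) < h (w a)" by linarith
  then show False
  proof cases
    case 1
    with a assms show ?thesis using lexval_less[of a m "h \<circ> w" "h \<circ> w'" D] by simp
  next
    case 2
    with a assms show ?thesis using lexval_less[of a m "h \<circ> w'" "h \<circ> w" D] by simp
  qed
qed

text \<open>
  An exponent of a Kronecker substitution: its base-\<open>(m+1)\<close> digits count the positions of given
  letter and colour.
\<close>
definition kronecker :: "nat \<Rightarrow> nat \<Rightarrow> ('a \<Rightarrow> nat) \<Rightarrow> (nat \<Rightarrow> nat) \<Rightarrow> (nat \<Rightarrow> 'a) \<Rightarrow> nat" where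
  "kronecker D m h c w = (\<Sum>a<m. Suc m ^ (h (w a) + D * c a))"

text \<open>The code \<open>h (w a) + D * c a\<close> determines letter and colour because
  \<open>h (w a) < D\<close>. Positions are grouped by code; a group has at most \<open>m\<close>
  members, so its size is a digit in base \<open>Suc m\<close>.\<close>

lemma kronecker_eq_digits:
  assumes "\<And>a. h a < D" "\<And>a. a < m \<Longrightarrow> c a < r"
  shows "kronecker D m h c w = (\<Sum>k<D * r. card {a. a < m \<and> h (w a) + D * c a = k} * Suc m ^ k)"
proof -
  have "h (w a) + D * c a < D * r" if "a < m" for a
  proof -
    have "h (w a) + D * c a < D * Suc (c a)" using assms(1)[of "w a"] by simp
    also have "\<dots> \<le> D * r" using assms(2)[OF that] by (intro mult_le_mono2) simp
    finally show ?thesis .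
  qed
  then have "kronecker D m h c w = (\<Sum>k<D * r. \<Sum>a | a \<in> {..<m} \<and> h (w a) + D * c a = k. Suc m ^ (h (w a) + D * c a))"
    unfolding kronecker_def by (intro sum.group[symmetric]) auto
  also have "\<dots> = (\<Sum>k<D * r. card {a. a < m \<and> h (w a) + D * c a = k} * Suc m ^ k)"
    by (rule sum.cong[OF refl]) simp
  finally show ?thesis .
qed

text \<open>Equal exponents mean that both words have the same letters, with multiplicity, in every
  colour class. As \<open>w\<^sub>0\<close> is weakly increasing on each class, it is the
  lexicographically least such arrangement.\<close>

lemma lexval_less_of_kronecker_eq:
  fixes h :: "'a \<Rightarrow> nat"
  assumes "inj h" and D: "\<And>a. h a < D" and w: "w\<^sub>0 \<in> {..<m} \<rightarrow>\<^sub>E UNIV" "w \<in> {..<m} \<rightarrow>\<^sub>E UNIV" "w \<noteq> w\<^sub>0"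
    and c: "\<And>a. a < m \<Longrightarrow> c a < r"
    and mono: "\<And>b a. b < a \<Longrightarrow> a < m \<Longrightarrow> c b = c a \<Longrightarrow> h (w\<^sub>0 b) \<le> h (w\<^sub>0 a)"
    and eq: "kronecker D m h c w = kronecker D m h c w\<^sub>0"
  shows "lexval D (h \<circ> w\<^sub>0) m < lexval D (h \<circ> w) m"
proof -
  define M where "M w k = card {a. a < m \<and> h (w a) + D * c a = k}" for w k
  have "M w k < Suc m" for w k
    unfolding M_def using card_mono[of "{..<m}" "{a. a < m \<and> h (w a) + D * c a = k}"]
    by (simp add: less_Suc_eq_le subset_eq)
  then have M: "M w k = M w\<^sub>0 k" if "k < D * r" for k
    using digits_unique[of "M w" "Suc m" "M w\<^sub>0" "D * r" k] eq that
    by (simp add: kronecker_eq_digits[OF D c] M_def)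
  obtain a where a: "a < m" "w a \<noteq> w\<^sub>0 a" "\<And>b. b < a \<Longrightarrow> w b = w\<^sub>0 b"
    using first_difference[OF w(2,1,3)] by metis
  have "h (w\<^sub>0 a) < h (w a)"
  proof (rule ccontr)
    assume "\<not> ?thesis"
    moreover have "h (w a) \<noteq> h (w\<^sub>0 a)" using a(2) \<open>inj h\<close> by (simp add: inj_eq)
    ultimately have less: "h (w a) < h (w\<^sub>0 a)" by simp
    define k where "k = h (w a) + D * c a"
    have "k < D * Suc (c a)" using D[of "w a"] by (simp add: k_def)
    also have "\<dots> \<le> D * r" using c[OF a(1)] by (intro mult_le_mono2) simp
    finally have k: "k < D * r" .
    have dec: "h (w\<^sub>0 b) = h (w a) \<and> c b = c a" if "h (w\<^sub>0 b) + D * c b = k" for b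
    proof -
      have "(h (w\<^sub>0 b) + D * c b) mod D = (h (w a) + D * c a) mod D"
        using that by (simp add: k_def)
      then have "h (w\<^sub>0 b) = h (w a)" using D[of "w\<^sub>0 b"] D[of "w a"] by simp
      moreover have "D > 0" using D[of "w a"] by simp
      ultimately show ?thesis using that by (simp add: k_def)
    qed
    \<comment> \<open>In \<open>w\<^sub>0\<close> this letter can occur in the class of
      \<open>a\<close> only before \<open>a\<close>, where the class already has a larger letter.
      Both words agree before \<open>a\<close>, so \<open>w\<close> has at least one occurrence
      more, namely at \<open>a\<close>.\<close>
    have "b < a" if "h (w\<^sub>0 b) + D * c b = k" "b < m" for b
    proof (rule ccontr)
      assume "\<not> b < a"
      have "h (w\<^sub>0 a) \<le> h (w\<^sub>0 b)"
      proof (cases "a = b")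
        case False
        with \<open>\<not> b < a\<close> have "a < b" by simp
        moreover have "c a = c b" using dec[OF that(1)] by simp
        ultimately show ?thesis using that(2) by (intro mono)
      qed simp
      with less dec[OF that(1)] show False by simp
    qed
    then have "{b. b < m \<and> h (w\<^sub>0 b) + D * c b = k} \<subseteq> {b. b < m \<and> h (w b) + D * c b = k}"
      using a(3) by auto
    moreover have "a \<in> {b. b < m \<and> h (w b) + D * c b = k}" "a \<notin> {b. b < m \<and> h (w\<^sub>0 b) + D * c b = k}"
      using a(1) less by (auto simp: k_def)
    ultimately have "{b. b < m \<and> h (w\<^sub>0 b) + D * c b = k} \<subset> {b. b < m \<and> h (w b) + D * c b = k}"
      by blast
    then have "M w\<^sub>0 k < M w k" unfolding M_def by (intro psubset_card_mono) simp
    with M[OF k] show False by simp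
  qed
  then show ?thesis
    by (intro lexval_less[OF a(1)]) (simp_all add: a(3) D)
qed

text \<open>A complex polynomial vanishing at all real points is zero; the claim is that its
  coefficient of degree \<open>k\<close> vanishes.\<close>

lemma vanishing_power_sum:
  fixes T :: "'b \<Rightarrow> complex"
  assumes "finite W" "\<And>t::real. (\<Sum>w\<in>W. T w * of_real t ^ E w) = 0"
  shows "(\<Sum>w | w \<in> W \<and> E w = k. T w) = 0"
proof -
  define q where "q = (\<Sum>w\<in>W. monom (T w) (E w))"
  have "poly q (of_real t) = 0" for t :: real
    using assms(2)[of t] by (simp add: q_def poly_sum poly_monom)
  then have "range (of_real :: real \<Rightarrow> complex) \<subseteq> {z. poly q z = 0}" by auto
  moreover have "infinite (range (of_real :: real \<Rightarrow> complex))"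
    using infinite_UNIV_char_0[where 'a = real] finite_imageD[OF _ inj_of_real] by blast
  ultimately have "q = 0" using poly_roots_finite[of q] by (metis finite_subset)
  then have "coeff q k = 0" by simp
  also have "coeff q k = (\<Sum>w\<in>W. if E w = k then T w else 0)"
    by (simp add: q_def coeff_sum)
  finally show ?thesis
    using assms(1) by (simp add: sum.inter_filter)
qed


text \<open>Two of the \<open>r + 1\<close> positions share one of the \<open>r\<close> colours, and
  exchanging their letters does not change the product. Consequently subtracting an alternating
  tensor preserves annihilation by maps to \<open>r\<close>-dimensional spaces.\<close>

lemma alternating_sum_vanishes:
  fixes G :: "'a \<Rightarrow> nat \<Rightarrow> complex"
  assumes inj: "inj_on e {0..<Suc r}" and e: "e ` {0..<Suc r} \<subseteq> {..<m}"
    and c: "\<And>a. a < m \<Longrightarrow> c a < r"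
  shows "(\<Sum>p | p permutes {0..<Suc r}. of_int (sign p) *
            (\<Prod>a<m. G (permute_letters (Suc r) e p w a) (c a))) = 0"
proof -
  have "(c \<circ> e) ` {0..<Suc r} \<subseteq> {..<r}" using e c by auto
  then have "card ((c \<circ> e) ` {0..<Suc r}) \<le> r" using card_mono[of "{..<r}"] by simp
  then have "\<not> inj_on (c \<circ> e) {0..<Suc r}" using card_image[of "c \<circ> e" "{0..<Suc r}"] by auto
  then obtain i j where ij: "i < Suc r" "j < Suc r" "i \<noteq> j" "c (e i) = c (e j)"
    by (auto simp: inj_on_def)
  have *: "(\<Prod>a<m. G (permute_letters (Suc r) e (p \<circ> transpose i j) w a) (c a))
      = (\<Prod>a<m. G (permute_letters (Suc r) e p w a) (c a))" for p
  proof -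
    let ?t = "transpose (e i) (e j)"
    have "e i < m" "e j < m" using e ij(1,2) by (auto simp: image_subset_iff)
    then have t: "?t permutes {..<m}" by (intro permutes_swap_id) simp_all
    have ct: "c (?t a) = c a" for a using ij(4) by (auto simp: transpose_def)
    have "(\<Prod>a<m. G (permute_letters (Suc r) e (p \<circ> transpose i j) w a) (c a))
       = (\<Prod>a<m. G (permute_letters (Suc r) e p w (?t a)) (c (?t a)))"
      using permute_letters_transpose[OF inj ij(1,2), of p w] by (simp add: ct)
    also have "\<dots> = (\<Prod>a<m. G (permute_letters (Suc r) e p w a) (c a))"
      using prod.permute[OF t, of "\<lambda>a. G (permute_letters (Suc r) e p w a) (c a)"] by (simp add: comp_def)
    finally show ?thesis .
  qed
  have "z = 0" if "z = - z" for z :: complex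
    using that by (simp add: complex_eq_iff)
  from this[OF module.alternating_sum_eq_uminus[OF module_mult ij(1-3), of "\<lambda>p. \<Prod>a<m. G (permute_letters (Suc r) e p w a) (c a)", OF *]]
  show ?thesis .
qed

text \<open>
  Hypothesis \<open>vanish\<close> says that \<open>T\<close> is annihilated by all linear maps to an \<open>r\<close>-dimensional space.
  The lexicographically last word of the support of \<open>T\<close> either contains a strictly
  decreasing chain of length \<open>r + 1\<close>, and is then removed by an alternating sum, or has
  an \<open>r\<close>-colouring that separates it from all smaller words.
\<close>
lemma tensor_second_fundamental:
  fixes \<Phi> :: "(nat \<Rightarrow> 'c::finite) \<Rightarrow> 'b::ab_group_add" and scale :: "complex \<Rightarrow> 'b \<Rightarrow> 'b"
    and T :: "(nat \<Rightarrow> 'c) \<Rightarrow> complex"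
  assumes "Modules.module scale" "module.subspace scale I"
    and alt: "\<And>e w. inj_on e {0..<Suc r} \<Longrightarrow> e ` {0..<Suc r} \<subseteq> {..<m} \<Longrightarrow> w \<in> {..<m} \<rightarrow>\<^sub>E UNIV \<Longrightarrow>
           (\<Sum>p | p permutes {0..<Suc r}. scale (of_int (sign p)) (\<Phi> (permute_letters (Suc r) e p w))) \<in> I"
    and vanish: "\<And>(c :: nat \<Rightarrow> nat) (g :: 'c \<Rightarrow> nat \<Rightarrow> real). (\<And>a. a < m \<Longrightarrow> c a < r) \<Longrightarrow>
           (\<Sum>w\<in>{..<m} \<rightarrow>\<^sub>E UNIV. T w * (\<Prod>a<m. of_real (g (w a) (c a)))) = 0"
  shows "(\<Sum>w\<in>{..<m} \<rightarrow>\<^sub>E UNIV. scale (T w) (\<Phi> w)) \<in> I"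
proof -
  interpret Modules.module scale by fact
  define W :: "(nat \<Rightarrow> 'c) set" where "W = {..<m} \<rightarrow>\<^sub>E UNIV"
  have finW: "finite W" unfolding W_def by (intro finite_PiE) auto
  obtain h :: "'c \<Rightarrow> nat" where "inj h"
    using finite_imp_inj_to_nat_seg[of "UNIV :: 'c set"] by auto
  define D where "D = Suc (Max (range h))"
  have D: "h a < D" for a by (simp add: D_def less_Suc_eq_le)
  define N where "N w = lexval D (h \<circ> w) m" for w
  have N_inj: "w = w'" if "w \<in> W" "w' \<in> W" "N w = N w'" for w w'
    using lexval_inj[OF \<open>inj h\<close> D] that unfolding W_def N_def by blast
  \<comment> \<open>The induction is on a strict bound \<open>K\<close> for the lexicographic values
    of the support, with \<open>T\<close> varying because each step replaces it.\<close>
  have "(\<Sum>w\<in>W. scale (T w) (\<Phi> w)) \<in> I"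
    if "\<And>(c :: nat \<Rightarrow> nat) (g :: 'c \<Rightarrow> nat \<Rightarrow> real). (\<And>a. a < m \<Longrightarrow> c a < r) \<Longrightarrow>
           (\<Sum>w\<in>W. T w * (\<Prod>a<m. of_real (g (w a) (c a)))) = 0"
      and "\<And>w. w \<in> W \<Longrightarrow> T w \<noteq> 0 \<Longrightarrow> N w < K" for K T
    using that
  proof (induction K arbitrary: T)
    case 0
    then have "T w = 0" if "w \<in> W" for w using that by blast
    then have "(\<Sum>w\<in>W. scale (T w) (\<Phi> w)) = 0" by (intro sum.neutral) simp
    then show ?case using subspace_0 assms(2) by simp
  next
    case (Suc K T)
    show ?case
    proof (cases "\<exists>w\<in>W. T w \<noteq> 0 \<and> N w = K")
      case False
      then have "N w < K" if "w \<in> W" "T w \<noteq> 0" for w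
        using Suc.prems(2)[OF that] that by (auto simp: less_Suc_eq)
      with Suc.IH Suc.prems(1) show ?thesis by blast
    next
      case True
      then obtain w\<^sub>0 where w0: "w\<^sub>0 \<in> W" "T w\<^sub>0 \<noteq> 0" "N w\<^sub>0 = K" by blast
      consider c where "\<And>a. a < m \<Longrightarrow> c a < r"
          "\<And>b a. b < a \<Longrightarrow> a < m \<Longrightarrow> h (w\<^sub>0 a) < h (w\<^sub>0 b) \<Longrightarrow> c b < c a"
        | e where "desc_chain (h \<circ> w\<^sub>0) e r" "e r < m"
        using colouring_or_desc_chain[of m r "h \<circ> w\<^sub>0"] unfolding comp_def by blast
      then show ?thesis
      proof cases
        case (1 c)
        define E where "E w = kronecker D m h c w" for w
        have mono: "h (w\<^sub>0 b) \<le> h (w\<^sub>0 a)" if "b < a" "a < m" "c b = c a" for a b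
          using 1(2)[OF that(1,2)] that(3) by (cases "h (w\<^sub>0 a) < h (w\<^sub>0 b)") auto
        have "(\<Sum>w\<in>W. T w * of_real t ^ E w) = 0" for t :: real
        proof -
          \<comment> \<open>One variable for each letter and colour, all specialized to powers of
            the single variable \<open>t\<close>, so that the word \<open>w\<close> contributes
            \<open>t ^ E w\<close>.\<close>
          define g where "g x j = t ^ (Suc m ^ (h x + D * j))" for x j
          have "(\<Prod>a<m. of_real (g (w a) (c a))) = (of_real t :: complex) ^ E w" for w
            unfolding g_def E_def kronecker_def by (simp add: power_sum)
          then show ?thesis using Suc.prems(1)[of c g, OF 1(1)] by simp
        qed
        then have "(\<Sum>w | w \<in> W \<and> E w = E w\<^sub>0. T w) = 0"
          by (rule vanishing_power_sum[OF finW])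
        \<comment> \<open>Any other word with the same exponent is lexicographically larger than
          \<open>w\<^sub>0\<close>, hence outside the support of \<open>T\<close>.\<close>
        also have "(\<Sum>w | w \<in> W \<and> E w = E w\<^sub>0. T w) = (\<Sum>w\<in>{w\<^sub>0}. T w)"
        proof (rule sum.mono_neutral_right)
          show "\<forall>w\<in>{w \<in> W. E w = E w\<^sub>0} - {w\<^sub>0}. T w = 0"
          proof (intro ballI, rule ccontr)
            fix w assume w: "w \<in> {w \<in> W. E w = E w\<^sub>0} - {w\<^sub>0}" "T w \<noteq> 0"
            then have "N w\<^sub>0 < N w"
              unfolding N_def
              using lexval_less_of_kronecker_eq[OF \<open>inj h\<close> D, of w\<^sub>0 m w c r] w0(1) 1(1) mono
              by (auto simp: W_def E_def)
            with Suc.prems(2)[of w] w w0(3) show False by simp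
          qed
        qed (use finW w0 in auto)
        finally show ?thesis using w0(2) by simp
      next
        case (2 e)
        have inj: "inj_on e {0..<Suc r}"
          using desc_chainD(1)[OF 2(1)] by (intro linorder_inj_onI) (auto simp: less_imp_neq)
        have e: "e ` {0..<Suc r} \<subseteq> {..<m}"
        proof
          fix b assume "b \<in> e ` {0..<Suc r}"
          then obtain i where "i < Suc r" "b = e i" by auto
          then show "b \<in> {..<m}" using desc_chainD(1)[OF 2(1), of i r] 2(2) by (cases "i = r") auto
        qed
        let ?P = "{p. p permutes {0..<Suc r}}"
        let ?w = "\<lambda>p. permute_letters (Suc r) e p w\<^sub>0"
        have finP: "finite ?P" by (simp add: finite_permutations)
        have wW: "?w p \<in> W" for p
          using permute_letters_in_words[OF inj e] w0(1) by (simp add: W_def)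
        have wN: "N (?w p) < K" if "p \<in> ?P" "p \<noteq> id" for p
          using permute_letters_lexval_less[OF 2, of p D] that D w0(3) by (simp add: N_def)
        \<comment> \<open>The alternating sum as a tensor. Its coefficient at
          \<open>w\<^sub>0\<close> is \<open>1\<close>, since all other rearrangements along the
          chain are smaller words.\<close>
        define A :: "(nat \<Rightarrow> 'c) \<Rightarrow> complex" where
          "A w = (\<Sum>p\<in>?P. if w = ?w p then of_int (sign p) else 0)" for w
        have A_sum: "(\<Sum>w\<in>W. A w * F w) = (\<Sum>p\<in>?P. of_int (sign p) * F (?w p))" for F :: "(nat \<Rightarrow> 'c) \<Rightarrow> complex"
        proof -
          have "(\<Sum>w\<in>W. A w * F w) = (\<Sum>w\<in>W. \<Sum>p\<in>?P. if w = ?w p then of_int (sign p) * F w else 0)"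
            by (auto simp: A_def sum_distrib_right intro!: sum.cong)
          also have "\<dots> = (\<Sum>p\<in>?P. \<Sum>w\<in>W. if w = ?w p then of_int (sign p) * F w else 0)"
            by (rule sum.swap)
          finally show ?thesis using finW wW by simp
        qed
        have A_scale: "(\<Sum>w\<in>W. scale (A w) (\<Phi> w)) = (\<Sum>p\<in>?P. scale (of_int (sign p)) (\<Phi> (?w p)))"
        proof -
          have "(\<Sum>w\<in>W. scale (A w) (\<Phi> w)) = (\<Sum>w\<in>W. \<Sum>p\<in>?P. if w = ?w p then scale (of_int (sign p)) (\<Phi> w) else 0)"
            by (auto simp: A_def scale_sum_left intro!: sum.cong)
          also have "\<dots> = (\<Sum>p\<in>?P. \<Sum>w\<in>W. if w = ?w p then scale (of_int (sign p)) (\<Phi> w) else 0)"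
            by (rule sum.swap)
          finally show ?thesis using finW wW by simp
        qed
        have A0: "A w\<^sub>0 = 1"
        proof -
          have "w\<^sub>0 = ?w p \<longleftrightarrow> p = id" if "p \<in> ?P" for p
            using wN[OF that] w0(3) permute_letters_id[OF inj, of w\<^sub>0] by (cases "p = id") auto
          then have "A w\<^sub>0 = (\<Sum>p\<in>?P. if p = id then of_int (sign p) else 0)"
            unfolding A_def by (intro sum.cong) auto
          also have "\<dots> = 1" using finP by (simp add: permutes_id sign_id)
          finally show ?thesis .
        qed
        \<comment> \<open>This clears the coefficient at \<open>w\<^sub>0\<close> and enlarges the
          support by smaller words only.\<close>
        define T' where "T' w = T w - T w\<^sub>0 * A w" for w
        have "(\<Sum>w\<in>W. scale (T' w) (\<Phi> w)) \<in> I"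
        proof (rule Suc.IH)
          fix c :: "nat \<Rightarrow> nat" and g :: "'c \<Rightarrow> nat \<Rightarrow> real"
          assume c: "\<And>a. a < m \<Longrightarrow> c a < r"
          have "(\<Sum>w\<in>W. A w * (\<Prod>a<m. of_real (g (w a) (c a)))) = 0"
            unfolding A_sum using alternating_sum_vanishes[where G = "\<lambda>x j. of_real (g x j)" and w = w\<^sub>0, OF inj e c] by simp
          then have "(\<Sum>w\<in>W. T w\<^sub>0 * (A w * (\<Prod>a<m. of_real (g (w a) (c a))))) = 0"
            by (simp only: sum_distrib_left[symmetric]) simp
          then show "(\<Sum>w\<in>W. T' w * (\<Prod>a<m. of_real (g (w a) (c a)))) = 0"
            using Suc.prems(1)[of c g, OF c] by (simp add: T'_def left_diff_distrib sum_subtractf mult.assoc)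
        next
          fix w assume w: "w \<in> W" "T' w \<noteq> 0"
          have ne: "w \<noteq> w\<^sub>0" using w(2) A0 by (auto simp: T'_def)
          show "N w < K"
          proof (cases "T w = 0")
            case True
            with w(2) have "A w \<noteq> 0" by (simp add: T'_def)
            then have "\<exists>p\<in>?P. (if w = ?w p then of_int (sign p) else (0::complex)) \<noteq> 0"
              unfolding A_def by (rule contrapos_np) (simp add: sum.neutral)
            then obtain p where "p \<in> ?P" "w = ?w p" by (auto split: if_splits)
            with ne wN[of p] permute_letters_id[OF inj, of w\<^sub>0] show ?thesis by (cases "p = id") auto
          next
            case False
            then show ?thesis using Suc.prems(2)[OF w(1)] N_inj[OF w(1) w0(1)] ne w0(3)
              by (cases "N w = K") auto
          qed
        qed
        moreover have "scale (T w\<^sub>0) (\<Sum>w\<in>W. scale (A w) (\<Phi> w)) \<in> I"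
          unfolding A_scale using alt[OF inj e, of w\<^sub>0] w0(1) assms(2)
          by (intro subspace_scale) (simp_all add: W_def)
        ultimately have "(\<Sum>w\<in>W. scale (T' w) (\<Phi> w)) + scale (T w\<^sub>0) (\<Sum>w\<in>W. scale (A w) (\<Phi> w)) \<in> I"
          using subspace_add assms(2) by blast
        also have "(\<Sum>w\<in>W. scale (T' w) (\<Phi> w)) + scale (T w\<^sub>0) (\<Sum>w\<in>W. scale (A w) (\<Phi> w))
            = (\<Sum>w\<in>W. scale (T w) (\<Phi> w))"
          by (simp add: T'_def scale_sum_right scale_left_diff_distrib sum_subtractf)
        finally show ?thesis .
      qed
    qed
  qed
  moreover have "\<exists>K. \<forall>w\<in>W. N w < K"
    using finite_nat_set_iff_bounded[of "N ` W"] finW by auto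
  ultimately show ?thesis using vanish unfolding W_def by blast
qed

section \<open>Minors of the flattening\<close>

text \<open>Positions \<open>2 * a\<close> and \<open>2 * a + 1\<close> of a word hold the two
  indices of the \<open>a\<close>-th factor $S^2 V$; the partner is the other position in the same
  factor.\<close>

definition pair_partner :: "nat \<Rightarrow> nat" where
  "pair_partner b = (if even b then Suc b else b - 1)"

lemma pair_partner_even: "even b \<Longrightarrow> b = 2 * (b div 2) \<and> pair_partner b = 2 * (b div 2) + 1"
  by (simp add: pair_partner_def)

lemma pair_partner_odd: "odd b \<Longrightarrow> b = 2 * (b div 2) + 1 \<and> pair_partner b = 2 * (b div 2)"
  by (simp add: pair_partner_def)

lemma pair_partner_div: "pair_partner b div 2 = b div 2"
  by (cases "even b") (auto simp: pair_partner_def elim!: oddE)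

lemma pair_partner_neq: "pair_partner b \<noteq> b"
  by (cases "even b") (auto simp: pair_partner_def elim!: oddE)

lemma same_pair:
  fixes x y :: nat
  assumes "x div 2 = y div 2" "x \<noteq> y"
  shows "x = 2 * (x div 2) \<and> y = 2 * (x div 2) + 1 \<or> y = 2 * (x div 2) \<and> x = 2 * (x div 2) + 1"
proof -
  have "x = 2 * (x div 2) \<or> x = 2 * (x div 2) + 1" "y = 2 * (y div 2) \<or> y = 2 * (y div 2) + 1"
    by presburger+
  with assms show ?thesis by metis
qed

definition word_var :: "(nat \<Rightarrow> 2) \<Rightarrow> (nat \<Rightarrow> 'n) \<Rightarrow> nat \<Rightarrow> 2 \<times> 'n uprod" where
  "word_var k w a = (k a, Upair (w (2 * a)) (w (2 * a + 1)))"

definition word_monom :: "nat \<Rightarrow> (nat \<Rightarrow> 2) \<Rightarrow> (nat \<Rightarrow> 'n) \<Rightarrow> (2 \<times> 'n uprod \<Rightarrow>\<^sub>0 nat)" where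
  "word_monom d k w = (\<Sum>a<d. Poly_Mapping.single (word_var k w a) 1)"

text \<open>Lifts the injectivity condition in \<open>minors\<close>: a repeated row or column makes
  the determinant zero.\<close>

lemma det_in_kappa0_ideal:
  "Determinant.det (mat (r + 1) (r + 1) (\<lambda>(a, b). flattening0 $ f a $ g b)) \<in> kappa0_ideal r"
    (is "Determinant.det ?M \<in> _")
proof -
  consider "inj_on f {..<r + 1}" "inj_on g {..<r + 1}"
    | i j where "i < r + 1" "j < r + 1" "i \<noteq> j" "f i = f j"
    | i j where "i < r + 1" "j < r + 1" "i \<noteq> j" "g i = g j"
    unfolding inj_on_def by blast
  then show ?thesis
  proof cases
    case 1
    then show ?thesis unfolding kappa0_ideal_def minors_def
      by (intro ideal_generated_base) blast
  next
    case (2 i j)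
    then have "Matrix.row ?M i = Matrix.row ?M j" by (intro eq_vecI) auto
    then have "Determinant.det ?M = 0"
      using det_identical_rows[of ?M "r + 1" i j] 2 by simp
    then show ?thesis by (simp add: kappa0_ideal_def ideal_generated_0)
  next
    case (3 i j)
    then have "Matrix.col ?M i = Matrix.col ?M j" by (intro eq_vecI) auto
    then have "Determinant.det ?M = 0"
      using det_identical_columns[of ?M "r + 1" i j] 3 by simp
    then show ?thesis by (simp add: kappa0_ideal_def ideal_generated_0)
  qed
qed

lemma module_const_mult: "Modules.module (\<lambda>c p. const c * p :: 'm cpoly)"
  by standard (simp_all add: algebra_simps const_add const_mult)

lemma cpoly_eq_uminus_iff: "(p :: 'm cpoly) = - p \<longleftrightarrow> p = 0"
proof
  assume "p = - p"
  then have "Poly_Mapping.lookup p m = - Poly_Mapping.lookup p m" for m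
    by (metis lookup_uminus)
  then show "p = 0" by (intro poly_mapping_eqI) simp
qed simp

text \<open>
  Alternating the letters in \<open>r + 1\<close> positions gives zero if two of the positions
  belong to the same symmetric factor, and otherwise a multiple of a minor.
\<close>
lemma alternating_sum_in_kappa0_ideal:
  fixes w :: "nat \<Rightarrow> 'n::finite"
  assumes inj: "inj_on e {0..<Suc r}" and e: "e ` {0..<Suc r} \<subseteq> {..<2 * d}"
  shows "(\<Sum>p | p permutes {0..<Suc r}. const (of_int (sign p)) *
           (\<Prod>a<d. pvar (word_var k (permute_letters (Suc r) e p w) a))) \<in> kappa0_ideal r"
    (is "?S \<in> _")
proof (cases "inj_on (\<lambda>i. e i div 2) {0..<Suc r}")
  case False
  then obtain i j where ij: "i < Suc r" "j < Suc r" "i \<noteq> j" "e i div 2 = e j div 2"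
    by (auto simp: inj_on_def)
  have "e i \<noteq> e j" using inj_onD[OF inj, of i j] ij by auto
  then have t: "e i = 2 * (e i div 2) \<and> e j = 2 * (e i div 2) + 1 \<or> e j = 2 * (e i div 2) \<and> e i = 2 * (e i div 2) + 1"
    by (rule same_pair[OF ij(4)])
  \<comment> \<open>Exchanging the two positions of one factor only exchanges the entries of an
    unordered pair.\<close>
  have "word_var k (u \<circ> transpose (e i) (e j)) a = word_var k u a" for u :: "nat \<Rightarrow> 'n" and a
  proof (cases "a = e i div 2")
    case True
    consider "e i = 2 * a" "e j = 2 * a + 1" | "e j = 2 * a" "e i = 2 * a + 1"
      using t[folded True] by blast
    then show ?thesis by cases (simp_all add: word_var_def transpose_def)
  next
    case False
    then have "e i div 2 \<noteq> a" "e j div 2 \<noteq> a" using ij(4) by simp_all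
    then have "2 * a \<noteq> e i" "2 * a \<noteq> e j" "2 * a + 1 \<noteq> e i" "2 * a + 1 \<noteq> e j" by auto
    then show ?thesis by (simp add: word_var_def transpose_def)
  qed
  then have "?S = - ?S"
    by (intro module.alternating_sum_eq_uminus[OF module_const_mult ij(1-3)])
       (simp add: permute_letters_transpose[OF inj ij(1,2)])
  then have "?S = 0" by (simp only: cpoly_eq_uminus_iff)
  then show ?thesis by (simp add: kappa0_ideal_def ideal_generated_0)
next
  case True
  let ?E = "(\<lambda>i. e i div 2) ` {0..<Suc r}"
  \<comment> \<open>The row is given by the \<open>U\<close>-index of the factor and the letter that
    stays in place at the partner position, the column by the letter being permuted.\<close>
  define f where "f i = (k (e i div 2), w (pair_partner (e i)))" for i
  define g where "g i = w (e i)" for i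
  define R where "R = (\<Prod>a\<in>{..<d} - ?E. pvar (word_var k w a) :: (2 \<times> 'n uprod) cpoly)"
  have E: "?E \<subseteq> {..<d}" using e by (auto simp: image_subset_iff)
  \<comment> \<open>The selected positions lie in distinct factors, so no partner is itself
    selected.\<close>
  have partner: "pair_partner (e i) \<notin> e ` {0..<Suc r}" if "i < Suc r" for i
  proof
    assume "pair_partner (e i) \<in> e ` {0..<Suc r}"
    then obtain j where j: "j < Suc r" "pair_partner (e i) = e j" by auto
    have "e j div 2 = e i div 2" using pair_partner_div[of "e i"] j(2) by simp
    then have "j = i" using inj_onD[OF True, of j i] that j(1) by simp
    with j(2) pair_partner_neq show False by metis
  qed
  have out: "word_var k (permute_letters (Suc r) e p w) a = word_var k w a" if "a \<notin> ?E" for a p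
  proof -
    have "b \<notin> e ` {0..<Suc r}" if "b div 2 = a" for b using that \<open>a \<notin> ?E\<close> by auto
    from this[of "2 * a"] this[of "2 * a + 1"]
    have "2 * a \<notin> e ` {0..<Suc r}" "2 * a + 1 \<notin> e ` {0..<Suc r}" by simp_all
    then show ?thesis by (simp add: word_var_def permute_letters_other)
  qed
  have "in": "pvar (word_var k (permute_letters (Suc r) e p w) (e i div 2)) = flattening0 $ f i $ g (p i)"
    if i: "i < Suc r" for i p
  proof -
    have "Upair (u (2 * (e i div 2))) (u (2 * (e i div 2) + 1)) = Upair (u (e i)) (u (pair_partner (e i)))"
      for u :: "nat \<Rightarrow> 'n"
    proof -
      define a where "a = e i div 2"
      have "(e i = 2 * a \<and> pair_partner (e i) = 2 * a + 1) \<or> (e i = 2 * a + 1 \<and> pair_partner (e i) = 2 * a)"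
        unfolding a_def using pair_partner_even pair_partner_odd by blast
      then show ?thesis unfolding a_def[symmetric] by (elim disjE conjE) simp_all
    qed
    then have "Upair (permute_letters (Suc r) e p w (2 * (e i div 2))) (permute_letters (Suc r) e p w (2 * (e i div 2) + 1))
        = Upair (permute_letters (Suc r) e p w (e i)) (permute_letters (Suc r) e p w (pair_partner (e i)))" .
    also have "\<dots> = Upair (w (pair_partner (e i))) (w (e (p i)))"
      using permute_letters_at[OF inj i] permute_letters_other[OF partner[OF i]] by auto
    finally have *: "Upair (permute_letters (Suc r) e p w (2 * (e i div 2)))
        (permute_letters (Suc r) e p w (2 * (e i div 2) + 1)) = Upair (w (pair_partner (e i))) (w (e (p i)))" .
    show ?thesis unfolding word_var_def * by (simp add: f_def g_def flattening0_def)
  qed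
  have prod: "(\<Prod>a<d. pvar (word_var k (permute_letters (Suc r) e p w) a))
      = R * (\<Prod>i = 0..<Suc r. flattening0 $ f i $ g (p i))" for p
  proof -
    have "(\<Prod>a<d. pvar (word_var k (permute_letters (Suc r) e p w) a))
        = (\<Prod>a\<in>{..<d} - ?E. pvar (word_var k (permute_letters (Suc r) e p w) a)) *
          (\<Prod>a\<in>?E. pvar (word_var k (permute_letters (Suc r) e p w) a))"
      by (rule prod.subset_diff[OF E]) simp
    also have "(\<Prod>a\<in>{..<d} - ?E. pvar (word_var k (permute_letters (Suc r) e p w) a)) = R"
      unfolding R_def by (intro prod.cong refl) (simp add: out del: image_iff)
    also have "(\<Prod>a\<in>?E. pvar (word_var k (permute_letters (Suc r) e p w) a))
        = (\<Prod>i = 0..<Suc r. flattening0 $ f i $ g (p i))"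
      unfolding prod.reindex[OF True] by (intro prod.cong refl) (simp add: "in")
    finally show ?thesis .
  qed
  have "?S = R * (\<Sum>p | p permutes {0..<Suc r}. of_int (sign p) * (\<Prod>i = 0..<Suc r. flattening0 $ f i $ g (p i)))"
    unfolding prod sum_distrib_left
    by (intro sum.cong refl) (simp add: of_int_eq_const mult.left_commute del: prod.op_ivl_Suc)
  also have "(\<Sum>p | p permutes {0..<Suc r}. of_int (sign p) * (\<Prod>i = 0..<Suc r. flattening0 $ f i $ g (p i)))
      = Determinant.det (mat (r + 1) (r + 1) (\<lambda>(a, b). flattening0 $ f a $ g b))"
  proof -
    have "mat (r + 1) (r + 1) (\<lambda>(a, b). flattening0 $ f a $ g b) \<in> carrier_mat (Suc r) (Suc r)" by simp
    moreover have "p i < Suc r" if "p permutes {0..<Suc r}" "i < Suc r" for p i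
      using permutes_in_image[OF that(1), of i] that(2) by simp
    ultimately show ?thesis
      by (simp only: det_def') (intro sum.cong prod.cong arg_cong2[where f = "(*)"] refl, simp_all)
  qed
  finally show ?thesis
    using det_in_kappa0_ideal[of r f g] by (simp add: kappa0_ideal_def ideal_generated_mult)
qed

section \<open>Minors of the flattening on sums of \<open>r\<close> cone points\<close>

lemma homogeneous_minor:
  assumes "q \<in> minors s (flattening0 :: (2 \<times> 'n::finite uprod) cpoly ^ 'n ^ (2 \<times> 'n))"
  shows "homogeneous s q"
proof -
  obtain f g where q: "q = Determinant.det (mat s s (\<lambda>(a, b). flattening0 $ f a $ g b))"
    using assms by (auto simp: minors_def)
  have "homogeneous s (of_int (sign p) * (\<Prod>i = 0..<s. mat s s (\<lambda>(a, b). flattening0 $ f a $ g b) $$ (i, p i)))"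
    if "p permutes {0..<s}" for p
  proof -
    have "(\<Prod>i = 0..<s. mat s s (\<lambda>(a, b). flattening0 $ f a $ g b) $$ (i, p i)) = (\<Prod>i = 0..<s. flattening0 $ f i $ g (p i))"
      using that by (intro prod.cong) (auto simp: permutes_in_image)
    moreover have "homogeneous (card {0..<s}) (\<Prod>i = 0..<s. flattening0 $ f i $ g (p i) :: (2 \<times> 'n uprod) cpoly)"
      by (intro homogeneous_prod) (simp add: flattening0_def homogeneous_pvar[simplified])
    ultimately show ?thesis
      using homogeneous_mult[OF homogeneous_const] by (fastforce simp: of_int_eq_const)
  qed
  then show ?thesis unfolding q Determinant.det_def by (auto intro!: homogeneous_sum)
qed

lemma peval_minor_secant:
  fixes u :: "nat \<Rightarrow> complex ^ 2" and v :: "nat \<Rightarrow> complex ^ 'n::finite"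
  assumes "q \<in> minors (r + 1) (flattening0 :: (2 \<times> 'n uprod) cpoly ^ 'n ^ (2 \<times> 'n))"
  shows "peval q (\<Sum>l<r. tensor_sq (u l) (v l)) = 0"
proof -
  obtain f g where q: "q = Determinant.det (mat (r + 1) (r + 1) (\<lambda>(a, b). flattening0 $ f a $ g b))"
    using assms by (auto simp: minors_def)
  define x where "x = (\<Sum>l<r. tensor_sq (u l) (v l))"
  \<comment> \<open>The factorization through dimension \<open>r\<close> is padded to square
    matrices: the zero column \<open>r\<close> of \<open>A\<close> cancels row \<open>r\<close> of
    \<open>B\<close> in the product and gives \<open>det A = 0\<close>.\<close>
  define A where "A = mat (r + 1) (r + 1) (\<lambda>(a, l). if l < r then u l $ fst (f a) * v l $ snd (f a) else 0)"
  define B where "B = mat (r + 1) (r + 1) (\<lambda>(l, b). v l $ g b)"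
  define M where "M = mat (r + 1) (r + 1) (\<lambda>(a, b). peval (flattening0 $ f a $ g b) x)"
  have "peval q x = Determinant.det M"
    unfolding q M_def Determinant.det_def
    by (auto simp: peval_sum peval_prod permutes_in_image intro!: sum.cong prod.cong)
  also have "M = A * B"
  proof (rule eq_matI)
    fix a b assume ab: "a < dim_row (A * B)" "b < dim_col (A * B)"
    obtain k i where fa: "f a = (k, i)" by (cases "f a")
    have "M $$ (a, b) = (\<Sum>l<r. u l $ k * (v l $ i * v l $ g b))"
      using ab by (simp add: M_def A_def B_def fa peval_flattening0 slice_def x_def tensor_sq_def)
    also have "\<dots> = (\<Sum>l = 0..<r + 1. A $$ (a, l) * B $$ (l, b))"
      using ab by (simp add: A_def B_def fa lessThan_atLeast0 mult.assoc)
    finally show "M $$ (a, b) = (A * B) $$ (a, b)"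
      using ab by (simp add: A_def B_def scalar_prod_def)
  qed (auto simp: M_def A_def B_def)
  also have "Determinant.det (A * B) = Determinant.det A * Determinant.det B"
    by (rule det_mult[of _ "r + 1"]) (auto simp: A_def B_def)
  also have "Determinant.det A = 0"
  proof -
    have "(\<Prod>i = 0..<Suc r. A $$ (i, p i)) = 0" if p: "p permutes {0..<Suc r}" for p
    proof -
      obtain i where "p i = r" using permutes_surj[OF p] by (metis surjD)
      moreover from this have "i \<in> {0..<Suc r}" using permutes_in_image[OF p, of i] by simp
      ultimately have "A $$ (i, p i) = 0" unfolding A_def by simp
      with \<open>i \<in> _\<close> show ?thesis by (intro prod_zero) auto
    qed
    moreover have "A \<in> carrier_mat (Suc r) (Suc r)" by (simp add: A_def)
    ultimately show ?thesis by (simp only: det_def') (simp add: sum.neutral del: prod.op_ivl_Suc)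
  qed
  finally show ?thesis by (simp add: x_def)
qed

section \<open>Vanishing on real pencils\<close>

text \<open>For symmetric \<open>M\<close> these operators represent the elements of $S^2 W$, where
  W is the span of the \<open>r\<close> vectors \<open>\<gamma> c\<close>, which may be linearly
  dependent.\<close>

definition gram_form :: "nat \<Rightarrow> (nat \<Rightarrow> 'a::euclidean_space) \<Rightarrow> (nat \<Rightarrow> nat \<Rightarrow> real) \<Rightarrow> 'a \<Rightarrow> 'a" where
  "gram_form r \<gamma> M y = (\<Sum>c<r. \<Sum>c'<r. (M c c' * (\<gamma> c' \<bullet> y)) *\<^sub>R \<gamma> c)"

lemma pencil_eqI:
  fixes x y :: "'n::finite pencil"
  assumes "\<And>k i j. x $ (k, Upair i j) = y $ (k, Upair i j)"
  shows "x = y"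
  unfolding Finite_Cartesian_Product.vec_eq_iff
proof
  fix w :: "2 \<times> 'n uprod"
  obtain k q where w: "w = (k, q)" by (cases w)
  show "x $ w = y $ w" by (cases q) (simp add: w assms)
qed

lemma linear_gram_form: "linear (gram_form r \<gamma> M)"
proof (rule linearI)
  show "gram_form r \<gamma> M (x + y) = gram_form r \<gamma> M x + gram_form r \<gamma> M y" for x y
    by (simp add: gram_form_def inner_add_right distrib_left scaleR_add_left sum.distrib)
  show "gram_form r \<gamma> M (a *\<^sub>R x) = a *\<^sub>R gram_form r \<gamma> M x" for a x
    by (simp add: gram_form_def scaleR_sum_right mult.left_commute)
qed

lemma inner_gram_form: "x \<bullet> gram_form r \<gamma> M y = (\<Sum>c<r. \<Sum>c'<r. M c c' * (\<gamma> c \<bullet> x) * (\<gamma> c' \<bullet> y))"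
  by (simp add: gram_form_def inner_sum_right inner_commute mult_ac)

lemma gram_form_symmetric:
  assumes "\<And>c c'. M c c' = M c' c"
  shows "gram_form r \<gamma> M x \<bullet> y = x \<bullet> gram_form r \<gamma> M y"
proof -
  have "gram_form r \<gamma> M x \<bullet> y = (\<Sum>c<r. \<Sum>c'<r. M c c' * (\<gamma> c \<bullet> y) * (\<gamma> c' \<bullet> x))"
    by (subst inner_commute) (rule inner_gram_form)
  also have "\<dots> = (\<Sum>c'<r. \<Sum>c<r. M c c' * (\<gamma> c \<bullet> y) * (\<gamma> c' \<bullet> x))" by (rule sum.swap)
  also have "\<dots> = x \<bullet> gram_form r \<gamma> M y"
    unfolding inner_gram_form
  proof (intro sum.cong refl)
    fix c c'
    show "M c' c * (\<gamma> c' \<bullet> y) * (\<gamma> c \<bullet> x) = M c c' * (\<gamma> c \<bullet> x) * (\<gamma> c' \<bullet> y)"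
      using assms[of c c'] by simp
  qed
  finally show ?thesis .
qed

lemma dim_range_gram_form: "dim (range (gram_form r \<gamma> M)) \<le> r"
proof -
  have "range (gram_form r \<gamma> M) \<subseteq> span (\<gamma> ` {..<r})"
  proof
    fix x assume "x \<in> range (gram_form r \<gamma> M)"
    then obtain y where "x = gram_form r \<gamma> M y" by auto
    then show "x \<in> span (\<gamma> ` {..<r})"
      unfolding gram_form_def by (auto intro!: span_sum span_scale intro: span_base)
  qed
  then have "dim (range (gram_form r \<gamma> M)) \<le> card (\<gamma> ` {..<r})" by (intro dim_le_card) auto
  also have "\<dots> \<le> r" using card_image_le[of "{..<r}" \<gamma>] by simp
  finally show ?thesis .
qed

text \<open>A crude estimate from \<open>2 * \<bar>s c\<bar> * \<bar>s c'\<bar> \<le> (s c)\<^sup>2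
  + (s c')\<^sup>2\<close>; it only has to provide some threshold for \<open>t\<close>.\<close>

lemma quadratic_form_bound:
  fixes s :: "nat \<Rightarrow> real"
  shows "\<bar>\<Sum>c<r. \<Sum>c'<r. M c c' * s c * s c'\<bar> \<le> (\<Sum>c<r. \<Sum>c'<r. \<bar>M c c'\<bar>) * (\<Sum>c<r. (s c)\<^sup>2)"
proof -
  have "\<bar>\<Sum>c<r. \<Sum>c'<r. M c c' * s c * s c'\<bar> \<le> (\<Sum>c<r. \<Sum>c'<r. \<bar>M c c' * s c * s c'\<bar>)"
    by (intro order_trans[OF sum_abs] sum_mono sum_abs)
  also have "\<dots> \<le> (\<Sum>c<r. \<Sum>c'<r. \<bar>M c c'\<bar> * (\<Sum>c<r. (s c)\<^sup>2))"
  proof (intro sum_mono)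
    fix c c' assume c: "c \<in> {..<r}" "c' \<in> {..<r}"
    have le: "(s a)\<^sup>2 \<le> (\<Sum>c<r. (s c)\<^sup>2)" if "a \<in> {..<r}" for a
      using that by (intro member_le_sum) auto
    have "2 * \<bar>s c\<bar> * \<bar>s c'\<bar> \<le> (s c)\<^sup>2 + (s c')\<^sup>2"
      using sum_squares_bound[of "\<bar>s c\<bar>" "\<bar>s c'\<bar>"] by simp
    then have "\<bar>s c\<bar> * \<bar>s c'\<bar> \<le> (\<Sum>c<r. (s c)\<^sup>2)" using le[OF c(1)] le[OF c(2)] by linarith
    then show "\<bar>M c c' * s c * s c'\<bar> \<le> \<bar>M c c'\<bar> * (\<Sum>c<r. (s c)\<^sup>2)"
      by (simp add: abs_mult mult.assoc mult_left_mono)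
  qed
  also have "\<dots> = (\<Sum>c<r. \<Sum>c'<r. \<bar>M c c'\<bar>) * (\<Sum>c<r. (s c)\<^sup>2)"
    by (simp add: sum_distrib_right)
  finally show ?thesis .
qed

text \<open>Above the threshold the diagonal \<open>t\<close> dominates \<open>M\<close>, so the
  first form is at least a positive multiple of the sum of the
  \<open>(\<gamma> c \<bullet> x)\<^sup>2\<close>. It is therefore semidefinite, and its kernel is
  orthogonal to all \<open>\<gamma> c\<close>, where \<open>gram_form r \<gamma> L\<close> vanishes
  as well.\<close>

lemma gram_pencil_diagonalization:
  fixes \<gamma> :: "nat \<Rightarrow> 'a::euclidean_space"
  assumes "\<And>c c'. M c c' = M c' c" "\<And>c c'. L c c' = L c' c"
    and t: "(\<Sum>c<r. \<Sum>c'<r. \<bar>M c c'\<bar>) < t"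
  shows "\<exists>z \<tau>. \<forall>x. gram_form r \<gamma> (\<lambda>c c'. (if c = c' then t else 0) + M c c') x = (\<Sum>i<r. (z i \<bullet> x) *\<^sub>R z i) \<and>
                 gram_form r \<gamma> L x = (\<Sum>i<r. (\<tau> i * (z i \<bullet> x)) *\<^sub>R z i)"
proof (rule psd_pencil_diagonalization)
  let ?M = "\<lambda>c c'. (if c = c' then t else 0) + M c c'"
  show "linear (gram_form r \<gamma> ?M)" "linear (gram_form r \<gamma> L)" by (rule linear_gram_form)+
  show "gram_form r \<gamma> ?M x \<bullet> y = x \<bullet> gram_form r \<gamma> ?M y" for x y
    by (rule gram_form_symmetric) (simp add: assms(1))
  show "gram_form r \<gamma> L x \<bullet> y = x \<bullet> gram_form r \<gamma> L y" for x y
    by (rule gram_form_symmetric) (rule assms(2))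
  show "dim (range (gram_form r \<gamma> ?M)) \<le> r" by (rule dim_range_gram_form)
  let ?K = "\<Sum>c<r. \<Sum>c'<r. \<bar>M c c'\<bar>"
  have lower: "(t - ?K) * (\<Sum>c<r. (\<gamma> c \<bullet> x)\<^sup>2) \<le> x \<bullet> gram_form r \<gamma> ?M x" for x
  proof -
    have "x \<bullet> gram_form r \<gamma> ?M x =
        (\<Sum>c<r. \<Sum>c'<r. if c = c' then t * (\<gamma> c \<bullet> x)\<^sup>2 else 0) +
        (\<Sum>c<r. \<Sum>c'<r. M c c' * (\<gamma> c \<bullet> x) * (\<gamma> c' \<bullet> x))"
      unfolding inner_gram_form sum.distrib[symmetric]
      by (intro sum.cong refl) (simp add: distrib_right power2_eq_square)
    also have "(\<Sum>c<r. \<Sum>c'<r. if c = c' then t * (\<gamma> c \<bullet> x)\<^sup>2 else 0) = t * (\<Sum>c<r. (\<gamma> c \<bullet> x)\<^sup>2)"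
      by (simp add: sum_distrib_left)
    finally show ?thesis
      using quadratic_form_bound[of M "\<lambda>c. \<gamma> c \<bullet> x" r] by (simp add: left_diff_distrib abs_le_iff)
  qed
  have nonneg: "0 \<le> (\<Sum>c<r. (\<gamma> c \<bullet> x)\<^sup>2)" for x by (simp add: sum_nonneg)
  show "0 \<le> x \<bullet> gram_form r \<gamma> ?M x" for x
  proof -
    have "0 \<le> (t - ?K) * (\<Sum>c<r. (\<gamma> c \<bullet> x)\<^sup>2)" by (intro mult_nonneg_nonneg nonneg) (use t in linarith)
    then show ?thesis using lower[of x] by (rule order_trans)
  qed
  show "gram_form r \<gamma> L x = 0" if "gram_form r \<gamma> ?M x = 0" for x
  proof -
    have "(t - ?K) * (\<Sum>c<r. (\<gamma> c \<bullet> x)\<^sup>2) \<le> 0" using lower[of x] that by simp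
    moreover have "0 < (t - ?K) * (\<Sum>c<r. (\<gamma> c \<bullet> x)\<^sup>2)" if "(\<Sum>c<r. (\<gamma> c \<bullet> x)\<^sup>2) \<noteq> 0"
      using that nonneg[of x] t by (intro mult_pos_pos) linarith+
    ultimately have "(\<Sum>c<r. (\<gamma> c \<bullet> x)\<^sup>2) = 0" by (meson not_le)
    then have "\<forall>c\<in>{..<r}. (\<gamma> c \<bullet> x)\<^sup>2 = 0"
      by (subst (asm) sum_nonneg_eq_0_iff) auto
    then have "\<gamma> c \<bullet> x = 0" if "c < r" for c
      using that by simp
    then show ?thesis by (simp add: gram_form_def)
  qed
qed

text \<open>
  The pencils \<open>t x\<^sub>0 + x\<close>, where the first matrix of \<open>x\<^sub>0\<close> is the Gram matrix of the \<open>g\<close> and the second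
  is zero, are sums of \<open>r\<close> squares for large \<open>t\<close>; the polynomial thus vanishes for all \<open>t\<close>.
\<close>
lemma vanish_on_real_pencils:
  fixes x :: "'n::finite pencil" and B :: "2 \<Rightarrow> nat \<Rightarrow> nat \<Rightarrow> real" and g :: "'n \<Rightarrow> nat \<Rightarrow> real"
    and r :: nat
  assumes vanish: "\<And>u v. peval p (\<Sum>l<r. tensor_sq (u l) (v l) :: 'n pencil) = 0"
    and sym: "\<And>k c c'. B k c c' = B k c' c"
    and x: "\<And>k i j. x $ (k, Upair i j) = of_real (\<Sum>c<r. \<Sum>c'<r. B k c c' * g i c * g j c')"
  shows "peval p x = 0"
proof -
  define \<gamma> :: "nat \<Rightarrow> real ^ 'n" where "\<gamma> c = (\<chi> i. g i c)" for c
  define x\<^sub>0 :: "'n pencil" where "x\<^sub>0 = (\<Sum>c<r. tensor_sq (axis 1 1) (\<chi> i. of_real (g i c)))"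
  obtain q where q: "\<And>t. poly q t = peval p (t *s x\<^sub>0 + x)" using poly_along_line by blast
  have zero: "poly q (of_real t) = 0" if t: "(\<Sum>c<r. \<Sum>c'<r. \<bar>B 1 c c'\<bar>) < t" for t
  proof -
    obtain z \<tau> where z_all: "\<forall>y. gram_form r \<gamma> (\<lambda>c c'. (if c = c' then t else 0) + B 1 c c') y = (\<Sum>i<r. (z i \<bullet> y) *\<^sub>R z i) \<and>
        gram_form r \<gamma> (B 2) y = (\<Sum>i<r. (\<tau> i * (z i \<bullet> y)) *\<^sub>R z i)"
      using gram_pencil_diagonalization[where M = "B 1" and L = "B 2" and \<gamma> = \<gamma>, OF sym sym t] by blast
    note z = z_all[THEN spec, THEN conjunct1] z_all[THEN spec, THEN conjunct2]
    have gram: "axis i 1 \<bullet> gram_form r \<gamma> M (axis j 1) = (\<Sum>c<r. \<Sum>c'<r. M c c' * g i c * g j c')" for M i j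
      by (simp add: inner_gram_form inner_axis \<gamma>_def)
    \<comment> \<open>The square of \<open>z l\<close> occurs with coefficient \<open>1\<close> in
      the first matrix and \<open>\<tau> l\<close> in the second, so its vector in $U^*$ is
      \<open>(1, \<tau> l)\<close>.\<close>
    define u :: "nat \<Rightarrow> complex ^ 2" where "u l = (\<chi> k. if k = 1 then 1 else of_real (\<tau> l))" for l
    define v :: "nat \<Rightarrow> complex ^ 'n" where "v l = (\<chi> i. of_real (z l $ i))" for l
    have "(of_real t *s x\<^sub>0 + x) $ (k, Upair i j) = (\<Sum>l<r. tensor_sq (u l) (v l)) $ (k, Upair i j)" for k i j
    proof (cases "k = 1")
      case True
      have "(\<Sum>c<r. \<Sum>c'<r. ((if c = c' then t else 0) + B 1 c c') * g i c * g j c')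
          = (\<Sum>c<r. \<Sum>c'<r. if c = c' then t * g i c * g j c else 0) + (\<Sum>c<r. \<Sum>c'<r. B 1 c c' * g i c * g j c')"
        unfolding sum.distrib[symmetric] by (intro sum.cong refl) (simp add: distrib_right)
      also have "(\<Sum>c<r. \<Sum>c'<r. if c = c' then t * g i c * g j c else 0) = t * (\<Sum>c<r. g i c * g j c)"
        by (simp add: sum_distrib_left mult.assoc)
      finally have "t * (\<Sum>c<r. g i c * g j c) + (\<Sum>c<r. \<Sum>c'<r. B 1 c c' * g i c * g j c')
          = (\<Sum>l<r. z l $ j * z l $ i)"
        by (simp add: gram[symmetric] z(1) inner_sum_right inner_axis inner_axis')
      then have "complex_of_real (t * (\<Sum>c<r. g i c * g j c) + (\<Sum>c<r. \<Sum>c'<r. B 1 c c' * g i c * g j c'))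
          = of_real (\<Sum>l<r. z l $ j * z l $ i)" by (rule arg_cong)
      then show ?thesis
        by (simp add: True x x\<^sub>0_def tensor_sq_def u_def v_def axis_def mult.commute)
    next
      case False
      then have k: "k = 2" using exhaust_2[of k] by simp
      have "(\<Sum>c<r. \<Sum>c'<r. B 2 c c' * g i c * g j c') = (\<Sum>l<r. \<tau> l * (z l $ j * z l $ i))"
        unfolding gram[symmetric] z(2) by (simp add: inner_sum_right inner_axis inner_axis' mult.assoc)
      then have "complex_of_real (\<Sum>c<r. \<Sum>c'<r. B 2 c c' * g i c * g j c') = of_real (\<Sum>l<r. \<tau> l * (z l $ j * z l $ i))"
        by (rule arg_cong)
      then show ?thesis
        by (simp add: k x x\<^sub>0_def tensor_sq_def u_def v_def axis_def mult.commute)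
    qed
    then have "of_real t *s x\<^sub>0 + x = (\<Sum>l<r. tensor_sq (u l) (v l))"
      by (rule pencil_eqI)
    then show ?thesis using q vanish by simp
  qed
  have "q = 0"
  proof (rule ccontr)
    assume "q \<noteq> 0"
    then have "finite {s. poly q s = 0}" by (rule poly_roots_finite)
    moreover have "of_real ` {\<Sum>c<r. \<Sum>c'<r. \<bar>B 1 c c'\<bar><..} \<subseteq> {s. poly q s = 0}" using zero by auto
    ultimately have "finite (complex_of_real ` {\<Sum>c<r. \<Sum>c'<r. \<bar>B 1 c c'\<bar><..})" by (rule finite_subset[rotated])
    then have "finite {\<Sum>c<r. \<Sum>c'<r. \<bar>B 1 c c'\<bar><..}" by (rule finite_imageD) (simp add: inj_on_def)
    then show False using infinite_Ioi by blast
  qed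
  then show ?thesis using q[of 0] by simp
qed

section \<open>Words and polarization\<close>

lemma prod_lessThan_double: "(\<Prod>b<2 * d. f b) = (\<Prod>a<d. f (2 * a) * f (2 * a + 1))" for f :: "nat \<Rightarrow> 'a::comm_monoid_mult"
  by (induction d) (simp_all add: mult.assoc)

lemma monomial_word_monom: "(\<Prod>a<d. pvar (word_var k w a)) = monomial (word_monom d k w)"
  unfolding word_monom_def by (rule monomial_sum_single[symmetric]) simp

lemma word_monom_surj:
  fixes m :: "2 \<times> 'n::finite uprod \<Rightarrow>\<^sub>0 nat"
  assumes "mdeg m = d"
  shows "\<exists>k\<in>{..<d} \<rightarrow>\<^sub>E UNIV. \<exists>w\<in>{..<2 * d} \<rightarrow>\<^sub>E UNIV. word_monom d k w = m"
proof -
  obtain v where v: "m = (\<Sum>a<d. Poly_Mapping.single (v a) 1)" using mdeg_decompose[OF assms] by blast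
  have "\<exists>i j. snd (v a) = Upair i j" for a by (cases "snd (v a)") blast
  then obtain i j where ij: "\<And>a. snd (v a) = Upair (i a) (j a)" by metis
  define k where "k = restrict (\<lambda>a. fst (v a)) {..<d}"
  define w where "w = restrict (\<lambda>b. if even b then i (b div 2) else j (b div 2)) {..<2 * d}"
  have "word_var k w a = v a" if "a < d" for a
    using that by (simp add: word_var_def k_def w_def ij[symmetric])
  then have "word_monom d k w = m" unfolding word_monom_def v by (intro sum.cong) auto
  moreover have "k \<in> {..<d} \<rightarrow>\<^sub>E UNIV" "w \<in> {..<2 * d} \<rightarrow>\<^sub>E UNIV" by (auto simp: k_def w_def)
  ultimately show ?thesis by blast
qed

text \<open>Each coefficient is shared equally among the words that spell its monomial. As
  \<open>T\<close> depends on the monomial alone, the resulting tensor is invariant under permuting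
  the factors and under exchanging the two letters of a factor.\<close>

lemma word_expansion:
  fixes p :: "(2 \<times> 'n::finite uprod) cpoly"
  assumes "homogeneous d p"
  obtains T where "p = (\<Sum>k\<in>{..<d} \<rightarrow>\<^sub>E UNIV. \<Sum>w\<in>{..<2 * d} \<rightarrow>\<^sub>E UNIV.
      const (T (word_monom d k w)) * (\<Prod>a<d. pvar (word_var k w a)))"
proof -
  define K :: "(nat \<Rightarrow> 2) set" where "K = {..<d} \<rightarrow>\<^sub>E UNIV"
  define W :: "(nat \<Rightarrow> 'n) set" where "W = {..<2 * d} \<rightarrow>\<^sub>E UNIV"
  have fin: "finite (K \<times> W)" unfolding K_def W_def by (intro finite_cartesian_product finite_PiE) auto
  define N where "N m = {u \<in> K \<times> W. word_monom d (fst u) (snd u) = m}" for m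
  define T where "T m = Poly_Mapping.lookup p m / of_nat (card (N m))" for m
  have "p = (\<Sum>k\<in>K. \<Sum>w\<in>W. const (T (word_monom d k w)) * monomial (word_monom d k w))" (is "_ = ?q")
  proof (rule poly_mapping_eqI)
    fix m
    have "Poly_Mapping.lookup ?q m =
        (\<Sum>u\<in>K \<times> W. T (word_monom d (fst u) (snd u)) * (if word_monom d (fst u) (snd u) = m then 1 else 0))"
      by (simp add: lookup_sum lookup_const_mult monomial_def lookup_single when_def sum.cartesian_product case_prod_beta)
    also have "\<dots> = (\<Sum>u\<in>K \<times> W. if word_monom d (fst u) (snd u) = m then T m else 0)"
      by (intro sum.cong) auto
    also have "\<dots> = (\<Sum>u\<in>N m. T m)"
      unfolding N_def using fin by (rule sum.inter_filter[symmetric])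
    also have "\<dots> = of_nat (card (N m)) * T m" by simp
    also have "\<dots> = Poly_Mapping.lookup p m"
    proof (cases "N m = {}")
      case True
      have "Poly_Mapping.lookup p m = 0"
      proof (rule ccontr)
        assume "\<not> ?thesis"
        then have "mdeg m = d" using assms by (simp add: homogeneous_iff)
        from word_monom_surj[OF this] obtain k w where "k \<in> K" "w \<in> W" "word_monom d k w = m"
          unfolding K_def W_def by blast
        then have "(k, w) \<in> N m" by (simp add: N_def)
        with True show False by simp
      qed
      then show ?thesis by (simp add: T_def)
    next
      case False
      moreover have "finite (N m)" unfolding N_def using fin by simp
      ultimately show ?thesis by (simp add: T_def)
    qed
    finally show "Poly_Mapping.lookup p m = Poly_Mapping.lookup ?q m" ..
  qed
  then show thesis unfolding K_def W_def by (intro that[of T]) (simp only: monomial_word_monom)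
qed

section \<open>Polarization by inclusion and exclusion\<close>

lemma alternating_superset_sum:
  assumes "finite A" "F \<subseteq> A"
  shows "(\<Sum>S\<in>Pow A. if F \<subseteq> S then (-1) ^ card S else 0) = (if F = A then (-1) ^ card A else (0::complex))"
proof -
  \<comment> \<open>The set \<open>S\<close> collects the factors from which \<open>-1\<close> is
    chosen; the remaining choices multiply to \<open>1\<close> exactly if
    \<open>F \<subseteq> S\<close>. The factor at a point outside \<open>F\<close> is zero, so only
    \<open>F = A\<close> survives.\<close>
  have "(\<Prod>x\<in>A. -1 + (if x \<in> F then 0 else 1 :: complex))
      = (\<Sum>S\<in>Pow A. (\<Prod>x\<in>S. -1) * (\<Prod>x\<in>A - S. if x \<in> F then 0 else 1))"
    by (rule prod_add) fact
  also have "\<dots> = (\<Sum>S\<in>Pow A. if F \<subseteq> S then (-1) ^ card S else 0)"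
  proof (rule sum.cong[OF refl])
    fix S assume S: "S \<in> Pow A"
    have "(\<Prod>x\<in>A - S. if x \<in> F then 0 else 1 :: complex) = (if F \<subseteq> S then 1 else 0)"
    proof (cases "F \<subseteq> S")
      case True
      then show ?thesis by (auto intro!: prod.neutral)
    next
      case False
      then have "\<exists>x\<in>A - S. (if x \<in> F then 0 else 1 :: complex) = 0" using assms(2) by auto
      then show ?thesis using False assms(1) by (simp add: prod_zero_iff)
    qed
    then show "(\<Prod>x\<in>S. -1) * (\<Prod>x\<in>A - S. if x \<in> F then 0 else 1) = (if F \<subseteq> S then (-1) ^ card S else (0::complex))"
      by simp
  qed
  also have "(\<Prod>x\<in>A. -1 + (if x \<in> F then 0 else 1 :: complex)) = (if F = A then (-1) ^ card A else 0)"
  proof (cases "F = A")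
    case False
    then have "\<exists>x\<in>A. -1 + (if x \<in> F then 0 else 1 :: complex) = 0" using assms(2) by auto
    then show ?thesis using False assms(1) by (simp add: prod_zero_iff)
  qed simp
  finally show ?thesis by simp
qed

lemma sum_bijective_eq_sum_permutations:
  "(\<Sum>f | f \<in> A \<rightarrow>\<^sub>E A \<and> f ` A = A. F f) = (\<Sum>p | p permutes A. F (restrict p A))" if "finite A"
proof (rule sum.reindex_bij_witness[where i = "\<lambda>p. restrict p A" and j = "\<lambda>f x. if x \<in> A then f x else x"])
  fix f assume f: "f \<in> {f. f \<in> A \<rightarrow>\<^sub>E A \<and> f ` A = A}"
  show r: "restrict (\<lambda>x. if x \<in> A then f x else x) A = f"
    using f by (auto simp: PiE_iff extensional_def restrict_def)
  have "bij_betw f A A" using f that by (simp add: bij_betw_def eq_card_imp_inj_on)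
  then have "bij_betw (\<lambda>x. if x \<in> A then f x else x) A A" by (subst bij_betw_cong[of A _ f]) auto
  then show "(\<lambda>x. if x \<in> A then f x else x) \<in> {p. p permutes A}" by (auto intro: bij_imp_permutes)
  show "F (restrict (\<lambda>x. if x \<in> A then f x else x) A) = F f" using r by simp
next
  fix p assume "p \<in> {p. p permutes A}"
  then have p: "p permutes A" by simp
  show "restrict p A \<in> {f. f \<in> A \<rightarrow>\<^sub>E A \<and> f ` A = A}"
    using permutes_image[OF p] permutes_in_image[OF p] by auto
  show "(\<lambda>x. if x \<in> A then restrict p A x else x) = p"
    using permutes_not_in[OF p] by auto
qed

text \<open>Ryser's formula for the permanent. Expanding each product over maps \<open>f\<close>
  into \<open>S\<close>, the signed sum over \<open>S\<close> retains only the surjective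
  \<open>f\<close>.\<close>

lemma ryser_formula:
  fixes z :: "nat \<Rightarrow> nat \<Rightarrow> complex"
  shows "(\<Sum>S\<in>Pow {..<d}. (-1) ^ card S * (\<Prod>b<d. \<Sum>a\<in>S. z a b))
       = (-1) ^ d * (\<Sum>p | p permutes {..<d}. \<Prod>b<d. z (p b) b)"
proof -
  let ?A = "{..<d}"
  let ?Z = "\<lambda>f. \<Prod>b<d. z (f b) b"
  have fin: "finite (?A \<rightarrow>\<^sub>E ?A)" by (intro finite_PiE) auto
  have expand: "(\<Prod>b<d. \<Sum>a\<in>S. z a b) = (\<Sum>f\<in>?A \<rightarrow>\<^sub>E ?A. if f ` ?A \<subseteq> S then ?Z f else 0)" if "S \<subseteq> ?A" for S
  proof -
    have "finite S" using that finite_subset by blast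
    then have "(\<Prod>b<d. \<Sum>a\<in>S. z a b) = (\<Sum>f\<in>?A \<rightarrow>\<^sub>E S. ?Z f)" by (intro prod_sum_PiE) auto
    also have "?A \<rightarrow>\<^sub>E S = {f \<in> ?A \<rightarrow>\<^sub>E ?A. f ` ?A \<subseteq> S}" using that by (auto simp: PiE_iff extensional_def)
    also have "(\<Sum>f\<in>\<dots>. ?Z f) = (\<Sum>f\<in>?A \<rightarrow>\<^sub>E ?A. if f ` ?A \<subseteq> S then ?Z f else 0)"
      using fin by (rule sum.inter_filter)
    finally show ?thesis .
  qed
  have "(\<Sum>S\<in>Pow ?A. (-1) ^ card S * (\<Prod>b<d. \<Sum>a\<in>S. z a b))
      = (\<Sum>S\<in>Pow ?A. \<Sum>f\<in>?A \<rightarrow>\<^sub>E ?A. (if f ` ?A \<subseteq> S then (-1) ^ card S else 0) * ?Z f)"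
    by (intro sum.cong refl) (auto simp: expand sum_distrib_left intro!: sum.cong)
  also have "\<dots> = (\<Sum>f\<in>?A \<rightarrow>\<^sub>E ?A. \<Sum>S\<in>Pow ?A. (if f ` ?A \<subseteq> S then (-1) ^ card S else 0) * ?Z f)"
    by (rule sum.swap)
  also have "\<dots> = (\<Sum>f\<in>?A \<rightarrow>\<^sub>E ?A. (if f ` ?A = ?A then (-1) ^ d else 0) * ?Z f)"
  proof (rule sum.cong[OF refl])
    fix f assume "f \<in> ?A \<rightarrow>\<^sub>E ?A"
    then have "f ` ?A \<subseteq> ?A" by auto
    from alternating_superset_sum[OF finite_lessThan this]
    show "(\<Sum>S\<in>Pow ?A. (if f ` ?A \<subseteq> S then (-1) ^ card S else 0) * ?Z f) = (if f ` ?A = ?A then (-1) ^ d else 0) * ?Z f"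
      unfolding sum_distrib_right[symmetric] by simp
  qed
  also have "\<dots> = (\<Sum>f\<in>?A \<rightarrow>\<^sub>E ?A. if f ` ?A = ?A then (-1) ^ d * ?Z f else 0)"
    by (intro sum.cong) auto
  also have "\<dots> = (\<Sum>f\<in>{f \<in> ?A \<rightarrow>\<^sub>E ?A. f ` ?A = ?A}. (-1) ^ d * ?Z f)"
    using fin by (rule sum.inter_filter[symmetric])
  also have "\<dots> = (\<Sum>p | p permutes ?A. (-1) ^ d * ?Z (restrict p ?A))"
    by (rule sum_bijective_eq_sum_permutations[OF finite_lessThan, where F = "\<lambda>f. (-1) ^ d * ?Z f"])
  also have "\<dots> = (\<Sum>p | p permutes ?A. (-1) ^ d * (\<Prod>b<d. z (p b) b))" by simp
  finally show ?thesis by (simp only: sum_distrib_left)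
qed

lemma sum_words_permute:
  fixes F :: "('a \<Rightarrow> 'b) \<Rightarrow> 'c::comm_monoid_add"
  assumes "p permutes A"
  shows "(\<Sum>w\<in>A \<rightarrow>\<^sub>E UNIV. F (w \<circ> p)) = (\<Sum>w\<in>A \<rightarrow>\<^sub>E UNIV. F w)"
proof (rule sum.reindex_bij_witness[where i = "\<lambda>w. w \<circ> inv_into UNIV p" and j = "\<lambda>w. w \<circ> p"])
  have ext: "w \<circ> q \<in> A \<rightarrow>\<^sub>E UNIV" if "w \<in> A \<rightarrow>\<^sub>E UNIV" "q permutes A" for w :: "'a \<Rightarrow> 'b" and q
    using that permutes_not_in[OF that(2)] by (auto simp: PiE_iff extensional_def)
  fix w :: "'a \<Rightarrow> 'b" assume w: "w \<in> A \<rightarrow>\<^sub>E UNIV"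
  show "w \<circ> p \<circ> inv_into UNIV p = w" by (simp add: comp_assoc permutes_inv_o[OF assms])
  show "w \<circ> inv_into UNIV p \<circ> p = w" by (simp add: comp_assoc permutes_inv_o[OF assms])
  show "w \<circ> p \<in> A \<rightarrow>\<^sub>E UNIV" using ext w assms by blast
  show "w \<circ> inv_into UNIV p \<in> A \<rightarrow>\<^sub>E UNIV" using ext w permutes_inv[OF assms] by blast
qed simp

definition lift_pairs :: "(nat \<Rightarrow> nat) \<Rightarrow> nat \<Rightarrow> nat" where
  "lift_pairs p b = 2 * p (b div 2) + b mod 2"

lemma lift_pairs_permutes:
  assumes "p permutes {..<d}"
  shows "lift_pairs p permutes {..<2 * d}"
proof (rule bij_imp_permutes)
  have bound: "lift_pairs q b < 2 * d" if "q permutes {..<d}" "b < 2 * d" for q b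
  proof -
    have "b div 2 < d" using that(2) by simp
    then have "q (b div 2) < d" using permutes_in_image[OF that(1)] by auto
    then show ?thesis unfolding lift_pairs_def by simp
  qed
  have inv: "lift_pairs q (lift_pairs q' b) = b" if "\<And>a. q (q' a) = a" for q q' b
    by (simp add: lift_pairs_def that)
  show "bij_betw (lift_pairs p) {..<2 * d} {..<2 * d}"
    by (rule bij_betw_byWitness[where f' = "lift_pairs (inv_into UNIV p)"])
       (use bound[OF assms] bound[OF permutes_inv[OF assms]] inv permutes_inverses[OF assms] in auto)
  show "lift_pairs p b = b" if "b \<notin> {..<2 * d}" for b
    using permutes_not_in[OF assms, of "b div 2"] that by (simp add: lift_pairs_def)
qed

lemma word_var_lift_pairs: "word_var (k \<circ> p) (w \<circ> lift_pairs p) a = word_var k w (p a)"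
  by (simp add: word_var_def lift_pairs_def)

lemma word_monom_lift_pairs:
  assumes "p permutes {..<d}"
  shows "word_monom d (k \<circ> p) (w \<circ> lift_pairs p) = word_monom d k w"
  unfolding word_monom_def word_var_lift_pairs
  using sum.permute[OF assms, of "\<lambda>a. Poly_Mapping.single (word_var k w a) 1", symmetric] by (simp only: comp_def)

text \<open>Up to sign, \<open>ryser_formula\<close> turns the signed sum over \<open>S\<close> into
  the sum over all assignments of the \<open>x a\<close> to the factors. By the symmetry of the
  coefficients these \<open>d!\<close> sums are equal, and \<open>d!\<close> is invertible.\<close>

lemma polarization:
  fixes x :: "nat \<Rightarrow> 'n::finite pencil" and T :: "_ \<Rightarrow> complex"
  assumes "\<And>S. S \<subseteq> {..<d} \<Longrightarrow> (\<Sum>k\<in>{..<d} \<rightarrow>\<^sub>E UNIV. \<Sum>w\<in>{..<2 * d} \<rightarrow>\<^sub>E UNIV.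
      T (word_monom d k w) * (\<Prod>b<d. (\<Sum>a\<in>S. x a) $ word_var k w b)) = 0"
  shows "(\<Sum>k\<in>{..<d} \<rightarrow>\<^sub>E UNIV. \<Sum>w\<in>{..<2 * d} \<rightarrow>\<^sub>E UNIV. T (word_monom d k w) * (\<Prod>a<d. x a $ word_var k w a)) = 0"
    (is "?Z = 0")
proof -
  let ?K = "{..<d} \<rightarrow>\<^sub>E (UNIV :: 2 set)"
  let ?W = "{..<2 * d} \<rightarrow>\<^sub>E (UNIV :: 'n set)"
  let ?P = "{p. p permutes {..<d}}"
  have perm: "(\<Sum>k\<in>?K. \<Sum>w\<in>?W. T (word_monom d k w) * (\<Prod>b<d. x (p b) $ word_var k w b)) = ?Z" if p: "p permutes {..<d}" for p
  proof -
    have "(\<Prod>b<d. x (p b) $ word_var (k \<circ> p) (w \<circ> lift_pairs p) b) = (\<Prod>a<d. x a $ word_var k w a)" for k w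
      unfolding word_var_lift_pairs
      using prod.permute[OF p, of "\<lambda>a. x a $ word_var k w a"] by (simp add: comp_def)
    then have "?Z = (\<Sum>k\<in>?K. \<Sum>w\<in>?W. T (word_monom d (k \<circ> p) (w \<circ> lift_pairs p)) *
        (\<Prod>b<d. x (p b) $ word_var (k \<circ> p) (w \<circ> lift_pairs p) b))"
      by (simp add: word_monom_lift_pairs[OF p])
    also have "\<dots> = (\<Sum>k\<in>?K. \<Sum>w\<in>?W. T (word_monom d (k \<circ> p) w) * (\<Prod>b<d. x (p b) $ word_var (k \<circ> p) w b))"
      by (intro sum.cong refl sum_words_permute[OF lift_pairs_permutes[OF p]])
    also have "\<dots> = (\<Sum>k\<in>?K. \<Sum>w\<in>?W. T (word_monom d k w) * (\<Prod>b<d. x (p b) $ word_var k w b))"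
      by (rule sum_words_permute[OF p])
    finally show ?thesis ..
  qed
  have "0 = (\<Sum>S\<in>Pow {..<d}. (-1) ^ card S * (\<Sum>k\<in>?K. \<Sum>w\<in>?W.
      T (word_monom d k w) * (\<Prod>b<d. (\<Sum>a\<in>S. x a) $ word_var k w b)))"
    using assms by (intro sum.neutral[symmetric]) simp
  also have "\<dots> = (\<Sum>k\<in>?K. \<Sum>w\<in>?W. \<Sum>S\<in>Pow {..<d}. T (word_monom d k w) *
      ((-1) ^ card S * (\<Prod>b<d. \<Sum>a\<in>S. x a $ word_var k w b)))"
    unfolding sum_distrib_left sum.swap[of _ _ "Pow {..<d}"]
    by (simp add: mult.left_commute)
  also have "\<dots> = (\<Sum>k\<in>?K. \<Sum>w\<in>?W. T (word_monom d k w) *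
      ((-1) ^ d * (\<Sum>p\<in>?P. \<Prod>b<d. x (p b) $ word_var k w b)))"
    unfolding sum_distrib_left[symmetric] ryser_formula ..
  also have "\<dots> = (-1) ^ d * (\<Sum>p\<in>?P. \<Sum>k\<in>?K. \<Sum>w\<in>?W. T (word_monom d k w) * (\<Prod>b<d. x (p b) $ word_var k w b))"
    unfolding sum_distrib_left sum.swap[of _ _ ?P]
    by (simp add: mult.left_commute)
  also have "\<dots> = (-1) ^ d * (of_nat (card ?P) * ?Z)" by (simp add: perm)
  finally show ?thesis by (simp add: card_permutations[OF refl])
qed

section \<open>Symmetrization inside the factors\<close>

definition swap_pairs :: "nat set \<Rightarrow> nat \<Rightarrow> nat" where
  "swap_pairs S b = (if b div 2 \<in> S then pair_partner b else b)"

lemma pair_partner_involution: "pair_partner (pair_partner b) = b"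
  by (cases "even b") (auto simp: pair_partner_def elim!: oddE)

lemma swap_pairs_permutes:
  assumes "S \<subseteq> {..<d}"
  shows "swap_pairs S permutes {..<2 * d}"
proof (rule bij_imp_permutes)
  have inv: "swap_pairs S (swap_pairs S b) = b" for b
    by (simp add: swap_pairs_def pair_partner_div pair_partner_involution)
  have bound: "swap_pairs S b < 2 * d" if "b < 2 * d" for b
  proof -
    have "swap_pairs S b div 2 = b div 2" by (simp add: swap_pairs_def pair_partner_div)
    also have "\<dots> < d" using that by simp
    finally show ?thesis by simp
  qed
  show "bij_betw (swap_pairs S) {..<2 * d} {..<2 * d}"
    by (rule bij_betw_byWitness[where f' = "swap_pairs S"]) (use inv bound in auto)
  show "swap_pairs S b = b" if "b \<notin> {..<2 * d}" for b
  proof -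
    have "\<not> b div 2 < d" using that by simp
    then show ?thesis using assms by (auto simp: swap_pairs_def)
  qed
qed

lemma swap_pairs_even: "swap_pairs S (2 * a) = (if a \<in> S then 2 * a + 1 else 2 * a)"
  by (simp add: swap_pairs_def pair_partner_def)

lemma swap_pairs_odd: "swap_pairs S (2 * a + 1) = (if a \<in> S then 2 * a else 2 * a + 1)"
  by (simp add: swap_pairs_def pair_partner_def)

lemma word_var_swap_pairs: "word_var k (w \<circ> swap_pairs S) a = word_var k w a"
  unfolding word_var_def comp_apply swap_pairs_even swap_pairs_odd by simp

lemma word_monom_swap_pairs: "word_monom d k (w \<circ> swap_pairs S) = word_monom d k w"
  by (simp add: word_monom_def word_var_swap_pairs)

text \<open>Expanding the product selects a set \<open>S\<close> of factors whose letters are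
  exchanged. Reindexing the words by \<open>swap_pairs S\<close> undoes this without changing the
  coefficient, so all \<open>2 ^ d\<close> choices contribute equally.\<close>

lemma symmetrized_sum:
  fixes g :: "'n::finite \<Rightarrow> nat \<Rightarrow> complex"
  shows "(\<Sum>w\<in>{..<2 * d} \<rightarrow>\<^sub>E UNIV. T (word_monom d k w) *
      (\<Prod>a<d. g (w (2 * a)) (c (2 * a)) * g (w (2 * a + 1)) (c (2 * a + 1)) +
                g (w (2 * a + 1)) (c (2 * a)) * g (w (2 * a)) (c (2 * a + 1))))
    = 2 ^ d * (\<Sum>w\<in>{..<2 * d} \<rightarrow>\<^sub>E UNIV. T (word_monom d k w) * (\<Prod>b<2 * d. g (w b) (c b)))"
proof -
  let ?W = "{..<2 * d} \<rightarrow>\<^sub>E (UNIV :: 'n set)"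
  define \<alpha> where "\<alpha> w a = g (w (2 * a)) (c (2 * a)) * g (w (2 * a + 1)) (c (2 * a + 1))" for w a
  define \<beta> where "\<beta> w a = g (w (2 * a + 1)) (c (2 * a)) * g (w (2 * a)) (c (2 * a + 1))" for w a
  let ?Z = "\<Sum>w\<in>?W. T (word_monom d k w) * (\<Prod>a<d. \<alpha> w a)"
  have swap: "\<alpha> (w \<circ> swap_pairs S) a = (if a \<in> S then \<beta> w a else \<alpha> w a)" for w S a
    unfolding \<alpha>_def \<beta>_def comp_apply swap_pairs_even swap_pairs_odd by simp
  have split: "(\<Prod>a<d. \<alpha> (w \<circ> swap_pairs S) a) = (\<Prod>a\<in>S. \<beta> w a) * (\<Prod>a\<in>{..<d} - S. \<alpha> w a)"
    if "S \<subseteq> {..<d}" for w S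
  proof -
    have "(\<Prod>a<d. \<alpha> (w \<circ> swap_pairs S) a)
        = (\<Prod>a\<in>{..<d} - S. \<alpha> (w \<circ> swap_pairs S) a) * (\<Prod>a\<in>S. \<alpha> (w \<circ> swap_pairs S) a)"
      using that by (rule prod.subset_diff) simp
    then show ?thesis by (simp add: swap mult.commute)
  qed
  have "(\<Sum>w\<in>?W. T (word_monom d k w) * (\<Prod>a<d. \<beta> w a + \<alpha> w a))
      = (\<Sum>w\<in>?W. \<Sum>S\<in>Pow {..<d}. T (word_monom d k w) * ((\<Prod>a\<in>S. \<beta> w a) * (\<Prod>a\<in>{..<d} - S. \<alpha> w a)))"
    by (simp add: prod_add sum_distrib_left)
  also have "\<dots> = (\<Sum>S\<in>Pow {..<d}. \<Sum>w\<in>?W. T (word_monom d k w) * ((\<Prod>a\<in>S. \<beta> w a) * (\<Prod>a\<in>{..<d} - S. \<alpha> w a)))"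
    by (rule sum.swap)
  also have "\<dots> = (\<Sum>S\<in>Pow {..<d}. ?Z)"
  proof (rule sum.cong[OF refl])
    fix S assume "S \<in> Pow {..<d}"
    then have S: "S \<subseteq> {..<d}" by simp
    have "(\<Sum>w\<in>?W. T (word_monom d k w) * ((\<Prod>a\<in>S. \<beta> w a) * (\<Prod>a\<in>{..<d} - S. \<alpha> w a)))
        = (\<Sum>w\<in>?W. T (word_monom d k (w \<circ> swap_pairs S)) * (\<Prod>a<d. \<alpha> (w \<circ> swap_pairs S) a))"
      unfolding split[OF S] word_monom_swap_pairs ..
    also have "\<dots> = ?Z" by (rule sum_words_permute[OF swap_pairs_permutes[OF S]])
    finally show "(\<Sum>w\<in>?W. T (word_monom d k w) * ((\<Prod>a\<in>S. \<beta> w a) * (\<Prod>a\<in>{..<d} - S. \<alpha> w a))) = ?Z" .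
  qed
  also have "\<dots> = 2 ^ d * ?Z" by (simp add: card_Pow)
  finally show ?thesis unfolding prod_lessThan_double by (simp only: \<alpha>_def \<beta>_def add.commute)
qed

lemma sum_double_delta:
  fixes F :: "nat \<Rightarrow> nat \<Rightarrow> real"
  assumes "m < r" "m' < r"
  shows "(\<Sum>l<r. \<Sum>l'<r. (if l = m \<and> l' = m' then 1 else 0) * F l l') = F m m'"
proof -
  have "(if l = m \<and> l' = m' then 1 else 0) * F l l' = (if l' = m' then if l = m then F l l' else 0 else 0)" for l l'
    by simp
  then have "(\<Sum>l<r. \<Sum>l'<r. (if l = m \<and> l' = m' then 1 else 0) * F l l')
      = (\<Sum>l<r. \<Sum>l'<r. if l' = m' then if l = m then F l l' else 0 else 0)"
    by (simp only:)
  also have "\<dots> = (\<Sum>l<r. if l = m then F l m' else 0)"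
    using assms(2) by (simp only: sum.delta finite_lessThan lessThan_iff if_True)
  also have "\<dots> = F m m'"
    using assms(1) by (simp only: sum.delta finite_lessThan lessThan_iff if_True)
  finally show ?thesis .
qed

text \<open>
  Polarization at the pencils with the single nonzero matrix \<open>v v'\<^sup>T + v' v\<^sup>T\<close>, which is
  \<open>(v + v')\<^sup>2 - v\<^sup>2 - v'\<^sup>2\<close> in symmetric tensors.
\<close>
lemma word_tensor_vanishes:
  fixes p :: "(2 \<times> 'n::finite uprod) cpoly" and g :: "'n \<Rightarrow> nat \<Rightarrow> real" and c :: "nat \<Rightarrow> nat"
  assumes vanish: "\<And>u v. peval p (\<Sum>l<r. tensor_sq (u l) (v l)) = 0"
    and p: "p = (\<Sum>k\<in>{..<d} \<rightarrow>\<^sub>E UNIV. \<Sum>w\<in>{..<2 * d} \<rightarrow>\<^sub>E UNIV.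
              const (T (word_monom d k w)) * (\<Prod>a<d. pvar (word_var k w a)))"
    and k0: "k\<^sub>0 \<in> {..<d} \<rightarrow>\<^sub>E UNIV" and c: "\<And>b. b < 2 * d \<Longrightarrow> c b < r"
  shows "(\<Sum>w\<in>{..<2 * d} \<rightarrow>\<^sub>E UNIV. T (word_monom d k\<^sub>0 w) * (\<Prod>b<2 * d. of_real (g (w b) (c b)))) = 0"
proof -
  let ?K = "{..<d} \<rightarrow>\<^sub>E (UNIV :: 2 set)"
  let ?W = "{..<2 * d} \<rightarrow>\<^sub>E (UNIV :: 'n set)"
  define G :: "nat \<Rightarrow> complex ^ 'n" where "G l = (\<chi> i. of_real (g i l))" for l
  define x :: "nat \<Rightarrow> 'n pencil" where
    "x a = tensor_sq (axis (k\<^sub>0 a) 1) (G (c (2 * a)) + G (c (2 * a + 1)))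
         - tensor_sq (axis (k\<^sub>0 a) 1) (G (c (2 * a))) - tensor_sq (axis (k\<^sub>0 a) 1) (G (c (2 * a + 1)))" for a
  define s where "s i j a = g i (c (2 * a)) * g j (c (2 * a + 1)) + g j (c (2 * a)) * g i (c (2 * a + 1))" for i j a
  have x: "x a $ (k, Upair i j) = (if k = k\<^sub>0 a then of_real (s i j a) else 0)" for a k i j
  proof (cases "k = k\<^sub>0 a")
    case True
    have "(p + q) * (p' + q') - p * p' - q * q' = p * q' + p' * q" for p q p' q' :: complex
      by (simp add: algebra_simps)
    then show ?thesis by (simp add: True x_def tensor_sq_def G_def axis_def s_def)
  qed (simp add: x_def tensor_sq_def G_def axis_def)
  have eval: "peval p y = (\<Sum>k\<in>?K. \<Sum>w\<in>?W. T (word_monom d k w) * (\<Prod>a<d. y $ word_var k w a))" for y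
    by (subst p) (simp only: peval_sum peval_mult peval_const peval_prod peval_pvar)
  have "(\<Sum>k\<in>?K. \<Sum>w\<in>?W. T (word_monom d k w) * (\<Prod>a<d. x a $ word_var k w a)) = 0"
  proof (rule polarization)
    fix S assume S: "S \<subseteq> {..<d}"
    \<comment> \<open>The coefficients of the sum of the \<open>x a\<close> in products of the
      \<open>r\<close> vectors, which place it in $S^2$ of their span. When the two colours of a
      factor coincide, both indicators fall on the same diagonal entry, as in
      \<open>(v + v)\<^sup>2 - v\<^sup>2 - v\<^sup>2 = 2 v\<^sup>2\<close>.\<close>
    define B :: "2 \<Rightarrow> nat \<Rightarrow> nat \<Rightarrow> real" where
      "B k l l' = (\<Sum>a\<in>S. if k = k\<^sub>0 a then
          (if l = c (2 * a) \<and> l' = c (2 * a + 1) then 1 else 0) + (if l = c (2 * a + 1) \<and> l' = c (2 * a) then 1 else 0) else 0)"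
      for k l l'
    have sym: "B k l l' = B k l' l" for k l l'
      unfolding B_def by (intro sum.cong refl) (simp only: conj_commute add.commute)
    have "(\<Sum>a\<in>S. x a) $ (k, Upair i j) = of_real (\<Sum>l<r. \<Sum>l'<r. B k l l' * g i l * g j l')" for k i j
    proof -
      have delta: "(\<Sum>l<r. \<Sum>l'<r. (if l = m \<and> l' = m' then 1 else 0) * (g i l * g j l')) = g i m * g j m'"
        if "m < r" "m' < r" for m m'
        using that by (rule sum_double_delta)
      have "(\<Sum>l<r. \<Sum>l'<r. B k l l' * g i l * g j l')
          = (\<Sum>a\<in>S. \<Sum>l<r. \<Sum>l'<r. if k = k\<^sub>0 a then
              (if l = c (2 * a) \<and> l' = c (2 * a + 1) then 1 else 0) * (g i l * g j l') +
              (if l = c (2 * a + 1) \<and> l' = c (2 * a) then 1 else 0) * (g i l * g j l') else 0)"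
      proof -
        have "B k l l' * g i l * g j l' = (\<Sum>a\<in>S. if k = k\<^sub>0 a then
              (if l = c (2 * a) \<and> l' = c (2 * a + 1) then 1 else 0) * (g i l * g j l') +
              (if l = c (2 * a + 1) \<and> l' = c (2 * a) then 1 else 0) * (g i l * g j l') else 0)" for l l'
          unfolding B_def sum_distrib_right
        proof (rule sum.cong[OF refl])
          show "(if k = k\<^sub>0 a then (if l = c (2 * a) \<and> l' = c (2 * a + 1) then 1 else 0) +
                (if l = c (2 * a + 1) \<and> l' = c (2 * a) then 1 else 0) else 0) * g i l * g j l'
              = (if k = k\<^sub>0 a then (if l = c (2 * a) \<and> l' = c (2 * a + 1) then 1 else 0) * (g i l * g j l') +
                (if l = c (2 * a + 1) \<and> l' = c (2 * a) then 1 else 0) * (g i l * g j l') else 0)" for a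
            by (cases "k = k\<^sub>0 a") (simp_all only: simp_thms if_True if_False distrib_right mult.assoc mult_zero_left)
        qed
        then show ?thesis unfolding sum.swap[of _ _ S] by simp
      qed
      also have "\<dots> = (\<Sum>a\<in>S. if k = k\<^sub>0 a then s i j a else 0)"
      proof (rule sum.cong[OF refl])
        fix a assume "a \<in> S"
        then have "c (2 * a) < r" "c (2 * a + 1) < r" using S c[of "2 * a"] c[of "2 * a + 1"] by auto
        then show "(\<Sum>l<r. \<Sum>l'<r. if k = k\<^sub>0 a then
              (if l = c (2 * a) \<and> l' = c (2 * a + 1) then 1 else 0) * (g i l * g j l') +
              (if l = c (2 * a + 1) \<and> l' = c (2 * a) then 1 else 0) * (g i l * g j l') else 0)
            = (if k = k\<^sub>0 a then s i j a else 0)"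
          by (cases "k = k\<^sub>0 a") (simp_all only: simp_thms if_True if_False sum.distrib delta s_def
                sum.neutral_const mult.commute[of "g j (c (2 * a))"])
      qed
      finally have "complex_of_real (\<Sum>l<r. \<Sum>l'<r. B k l l' * g i l * g j l')
          = of_real (\<Sum>a\<in>S. if k = k\<^sub>0 a then s i j a else 0)" by (rule arg_cong)
      also have "\<dots> = (\<Sum>a\<in>S. x a $ (k, Upair i j))"
        unfolding of_real_sum by (intro sum.cong refl) (simp add: x)
      finally show ?thesis by simp
    qed
    from vanish_on_real_pencils[of p r B, OF vanish sym this]
    show "(\<Sum>k\<in>?K. \<Sum>w\<in>?W. T (word_monom d k w) * (\<Prod>b<d. (\<Sum>a\<in>S. x a) $ word_var k w b)) = 0"
      unfolding eval .
  qed
  \<comment> \<open>Each \<open>x a\<close> has only the matrix with index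
    \<open>k\<^sub>0 a\<close>, so any other list \<open>k\<close> produces a zero factor.\<close>
  also have "(\<Sum>k\<in>?K. \<Sum>w\<in>?W. T (word_monom d k w) * (\<Prod>a<d. x a $ word_var k w a))
      = (\<Sum>k\<in>{k\<^sub>0}. \<Sum>w\<in>?W. T (word_monom d k w) * (\<Prod>a<d. x a $ word_var k w a))"
  proof (rule sum.mono_neutral_right)
    show "finite ?K" by (intro finite_PiE) auto
    show "\<forall>k\<in>?K - {k\<^sub>0}. (\<Sum>w\<in>?W. T (word_monom d k w) * (\<Prod>a<d. x a $ word_var k w a)) = 0"
    proof
      fix k assume "k \<in> ?K - {k\<^sub>0}"
      then have "k \<in> ?K" "k \<noteq> k\<^sub>0" by simp_all
      then obtain a where a: "a < d" "k a \<noteq> k\<^sub>0 a"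
        by (rule first_difference[OF _ k0]) auto
      have "(\<Prod>a<d. x a $ word_var k w a) = 0" for w
      proof (rule prod_zero)
        have "x a $ word_var k w a = 0" using a(2) by (simp add: x word_var_def)
        with a(1) show "\<exists>a\<in>{..<d}. x a $ word_var k w a = 0" by blast
      qed simp
      then show "(\<Sum>w\<in>?W. T (word_monom d k w) * (\<Prod>a<d. x a $ word_var k w a)) = 0"
        by (simp only: mult_zero_right sum.neutral_const)
    qed
  qed (use k0 in auto)
  also have "\<dots> = (\<Sum>w\<in>?W. T (word_monom d k\<^sub>0 w) *
      (\<Prod>a<d. of_real (g (w (2 * a)) (c (2 * a))) * of_real (g (w (2 * a + 1)) (c (2 * a + 1))) +
                of_real (g (w (2 * a + 1)) (c (2 * a))) * of_real (g (w (2 * a)) (c (2 * a + 1)))))"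
    by (simp add: word_var_def x s_def)
  also have "\<dots> = 2 ^ d * (\<Sum>w\<in>?W. T (word_monom d k\<^sub>0 w) * (\<Prod>b<2 * d. of_real (g (w b) (c b))))"
    by (rule symmetrized_sum)
  finally show ?thesis by simp
qed

text \<open>The list \<open>k\<close> of \<open>U\<close>-indices is held fixed, so the second
  fundamental theorem concerns only the \<open>2 * d\<close> indices in $V$; the contributions of
  the different \<open>k\<close> are then added inside the ideal.\<close>

lemma vanishing_in_kappa0_ideal:
  fixes p :: "(2 \<times> 'n::finite uprod) cpoly"
  assumes "homogeneous d p" and vanish: "\<And>u v. peval p (\<Sum>l<r. tensor_sq (u l) (v l)) = 0"
  shows "p \<in> kappa0_ideal r"
proof -
  obtain T where p: "p = (\<Sum>k\<in>{..<d} \<rightarrow>\<^sub>E UNIV. \<Sum>w\<in>{..<2 * d} \<rightarrow>\<^sub>E UNIV.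
      const (T (word_monom d k w)) * (\<Prod>a<d. pvar (word_var k w a)))"
    using word_expansion[OF assms(1)] .
  have sub: "module.subspace (\<lambda>c p. const c * p) (kappa0_ideal r :: (2 \<times> 'n uprod) cpoly set)"
    unfolding module.subspace_def[OF module_const_mult] kappa0_ideal_def
    by (simp add: ideal_generated_0 ideal_generated_add ideal_generated_mult)
  have "(\<Sum>w\<in>{..<2 * d} \<rightarrow>\<^sub>E UNIV. const (T (word_monom d k w)) * (\<Prod>a<d. pvar (word_var k w a))) \<in> kappa0_ideal r"
    if "k \<in> {..<d} \<rightarrow>\<^sub>E UNIV" for k
    using module_const_mult sub
  proof (rule tensor_second_fundamental)
    show "(\<Sum>q | q permutes {0..<Suc r}. const (of_int (sign q)) *
        (\<Prod>a<d. pvar (word_var k (permute_letters (Suc r) e q w) a))) \<in> kappa0_ideal r"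
      if "inj_on e {0..<Suc r}" "e ` {0..<Suc r} \<subseteq> {..<2 * d}" for e and w :: "nat \<Rightarrow> 'n"
      using that by (rule alternating_sum_in_kappa0_ideal)
    show "(\<Sum>w\<in>{..<2 * d} \<rightarrow>\<^sub>E UNIV. T (word_monom d k w) * (\<Prod>b<2 * d. of_real (g (w b) (c b)))) = 0"
      if "\<And>b. b < 2 * d \<Longrightarrow> c b < r" for c :: "nat \<Rightarrow> nat" and g :: "'n \<Rightarrow> nat \<Rightarrow> real"
      using word_tensor_vanishes[OF vanish p \<open>k \<in> _\<close> that] .
  qed
  then show ?thesis
    unfolding kappa0_ideal_def by (subst p) (rule ideal_generated_sum)
qed

theorem proposition5p2:
  fixes r :: nat
  assumes "r > 1"
  shows "homogeneous_ideal (secant_variety r (segre_veronese :: ('n::finite pencil) set set))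
           = kappa0_ideal r"
proof
  let ?S = "{proj_point x | x. x \<noteq> 0 \<and> (\<exists>u v. x = (\<Sum>i<r. tensor_sq (u i) (v i)))} :: ('n pencil) set set"
  let ?\<sigma> = "secant_variety r (segre_veronese :: ('n pencil) set set)"
  let ?I = "{p. (\<exists>d. homogeneous d p) \<and> (\<forall>L\<in>?\<sigma>. vanishes_at p L)}"
  have \<sigma>: "?\<sigma> = zariski_closed hull ?S" by (rule secant_variety_segre_veronese)
  show "homogeneous_ideal ?\<sigma> \<subseteq> kappa0_ideal r"
    unfolding homogeneous_ideal_def kappa0_ideal_def
  proof (rule ideal_generated_minimal, rule subsetI)
    fix p assume "p \<in> ?I"
    then obtain d where d: "homogeneous d p" and "\<forall>L\<in>?\<sigma>. vanishes_at p L" by blast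
    then have L: "vanishes_at p L" if "L \<in> ?S" for L
      using that hull_subset[of ?S zariski_closed] unfolding \<sigma> by blast
    have nz: "peval p (\<Sum>i<r. tensor_sq (u i) (v i)) = 0" if "(\<Sum>i<r. tensor_sq (u i) (v i)) \<noteq> (0 :: 'n pencil)" for u v
    proof -
      let ?x = "\<Sum>i<r. tensor_sq (u i) (v i)"
      have "vanishes_at p (proj_point ?x)" using that by (intro L) blast
      moreover have "?x \<in> proj_point ?x"
        unfolding proj_point_def by (intro CollectI exI[of _ 1]) (simp add: Finite_Cartesian_Product.vec_eq_iff)
      ultimately show ?thesis by (simp add: vanishes_at_def)
    qed
    have "peval p (\<Sum>i<r. tensor_sq (u i) (v i)) = 0" for u :: "nat \<Rightarrow> complex ^ 2" and v :: "nat \<Rightarrow> complex ^ 'n"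
    proof (cases "(\<Sum>i<r. tensor_sq (u i) (v i)) = 0")
      case True
      \<comment> \<open>Projective points say nothing directly about the value at \<open>0\<close>.
        It is obtained by scaling a nonzero sum \<open>y\<close> by \<open>0\<close>, which also
        covers \<open>d = 0\<close>; \<open>y\<close> is nonzero because it has a coordinate equal
        to \<open>r\<close>.\<close>
      define y :: "'n pencil" where "y = (\<Sum>i<r. tensor_sq 1 1)"
      have "y $ (1, Upair undefined undefined) = of_nat r"
        unfolding y_def sum_component by (simp add: tensor_sq_def)
      have "y \<noteq> 0"
      proof
        assume "y = 0"
        with \<open>y $ (1, Upair undefined undefined) = of_nat r\<close> assms show False by simp
      qed
      then have "peval p y = 0" unfolding y_def by (rule nz)
      then have "peval p (0 *s y) = 0" unfolding peval_scale[OF d] by simp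
      moreover have "0 *s y = 0" by (simp add: Finite_Cartesian_Product.vec_eq_iff)
      ultimately show ?thesis by (simp add: True)
    qed (rule nz)
    from vanishing_in_kappa0_ideal[OF d this]
    show "p \<in> ideal_generated (minors (r + 1) flattening0)" unfolding kappa0_ideal_def .
  qed
  show "kappa0_ideal r \<subseteq> homogeneous_ideal ?\<sigma>"
    unfolding homogeneous_ideal_def kappa0_ideal_def
  proof (rule ideal_generated_minimal, rule subsetI)
    fix q :: "(2 \<times> 'n uprod) cpoly" assume q: "q \<in> minors (r + 1) flattening0"
    have hom: "homogeneous (r + 1) q" by (rule homogeneous_minor[OF q])
    let ?Z = "{L \<in> proj_space. \<forall>p\<in>{q}. vanishes_at p L}"
    have "?S \<subseteq> ?Z"
    proof
      fix L assume "L \<in> ?S"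
      then obtain x u v where x: "L = proj_point x" "x \<noteq> 0" "x = (\<Sum>i<r. tensor_sq (u i) (v i))" by blast
      have "peval q (c *s x) = 0" for c
        using peval_minor_secant[OF q, of u v] by (simp add: peval_scale[OF hom] x(3))
      then have "vanishes_at q L" by (auto simp: vanishes_at_def x(1) proj_point_def)
      then show "L \<in> ?Z" using x by (auto simp: proj_space_def)
    qed
    moreover have "zariski_closed ?Z" unfolding zariski_closed_def using hom by blast
    ultimately have "?\<sigma> \<subseteq> ?Z" unfolding \<sigma> by (rule hull_minimal)
    then have "q \<in> ?I" using hom by blast
    then show "q \<in> ideal_generated ?I" by (rule ideal_generated_base)
  qed
qed

end
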